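(* Let $n\ge 4$ be an integer and let $L,\mu_x,\mu_y,R_x,R_y,\varepsilon>0$. Put $\kappa_x=L/\mu_x$, $\kappa_y=L/\mu_y$ and assume $\kappa_x\ge\kappa_y\ge 2$ and $$\varepsilon\le\min\left\{\frac{n\mu_xR_x^2}{800\,\kappa_x\kappa_y},\ \frac{\mu_xR_x^2}{720},\ \frac{\mu_yR_y^2}{800}\right\}.$$ Then $$\mathfrak m^{\mathrm{CC}}(\varepsilon,R_x,R_y,L,\mu_x,\mu_y)=\begin{cases}\Omega\big((n+\sqrt{\kappa_x\kappa_y n})\log(1/\varepsilon)\big), & \kappa_x,\kappa_y=\Omega(\sqrt n),\\ \Omega\big((n+n^{3/4}\sqrt{\kappa_x})\log(1/\varepsilon)\big), & \kappa_x=\Omega(\sqrt n),\ \kappa_y=O(\sqrt n),\\ \Omega(n), & \kappa_x,\kappa_y=O(\sqrt n).\end{cases}$$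
   Context: Norms are Euclidean. $\mathcal P_{\mathcal X}$ is Euclidean projection onto a closed convex set $\mathcal X$. Problem: $\min_{x\in\mathcal X}\max_{y\in\mathcal Y} f(x,y)=\frac1n\sum_{i=1}^n f_i(x,y)$, with $\mathcal X\subseteq\mathbb R^{d_x}$, $\mathcal Y\subseteq\mathbb R^{d_y}$ closed and convex. A family $\{f_i\}_{i=1}^n$ of differentiable functions is $L$-average smooth if $\frac1n\sum_i\|\nabla f_i(z_1)-\nabla f_i(z_2)\|^2\le L^2\|z_1-z_2\|^2$ for all $z_1,z_2$ in the domain. $f$ is $(\mu_x,\mu_y)$-convex-concave if $f(x,y)-\frac{\mu_x}2\|x\|^2+\frac{\mu_y}2\|y\|^2$ is convex in $x$ for every fixed $y$ and concave in $y$ for every fixed $x$. PIFO algorithms. Fix an absolute constant $c_0>0$ (e.g. $c_0=2$). The oracle $h^{\mathrm{PIFO}}_{f_i}(x,y,\gamma)$, $\gamma>0$, returns $[f_i(x,y),\nabla_xf_i(x,y),-\nabla_yf_i(x,y),\mathrm{prox}^\gamma_{f_i}(x,y)]$, where $\mathrm{prox}^\gamma_{f_i}(x,y)$ is the min-max point over $(u,v)\in\mathbb R^{d_x}\times\mathbb R^{d_y}$ (min in $u$, max in $v$) of $f_i(u,v)+\frac1{2\gamma}\|x-u\|^2-\frac1{2\gamma}\|y-v\|^2$ (when $f_i$ is not convex-concave, $\gamma$ must be such that this function is convex-concave in $(u,v)$). The oracle $h^{\mathrm{FO}}_f(x,y)$ returns $[f,\nabla_xf,-\nabla_yf](x,y)$.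 A PIFO algorithm $\mathcal A$ fixes a distribution $\mathcal D$ on $\{1,\dots,n\}$ and $0<q\le c_0/n$, starts at $(x_0,y_0)=(0,0)$ with $\mathcal H=\{(x_0,y_0)\}$, and at step $t=1,2,\dots$: (i) samples $i_t\sim\mathcal D$ and queries $h^{\mathrm{PIFO}}_{f_{i_t}}$; (ii) samples $a_t\sim\mathrm{Bernoulli}(q)$ and, if $a_t=1$, queries $h^{\mathrm{FO}}_f$ and adds $(x_{t-1},y_{t-1})$ to $\mathcal H$; (iii) chooses $(\tilde x_t,\tilde y_t)$ in the linear span of $(x_0,y_0),\dots,(x_{t-1},y_{t-1})$; $\mathrm{prox}^{\gamma_j}_{f_{i_j}}(x_l,y_l)$, $(\nabla_xf_{i_j}(x_l,y_l),0)$ and $(0,-\nabla_yf_{i_j}(x_l,y_l))$ for $l<j\le t$; and $(\nabla_xf(u,v),0)$, $(0,-\nabla_yf(u,v))$ for $(u,v)\in\mathcal H$; (iv) sets $x_t=\mathcal P_{\mathcal X}(\tilde x_t)$, $y_t=\mathcal P_{\mathcal Y}(\tilde y_t)$; (v) outputs $(x_t,y_t)$ or continues with $t+1$. The pairs $(i_t,a_t)$, $t\ge1$, are mutually independent and $i_t$ is independent of $a_t$. $\mathscr A$ is the class of all PIFO algorithms. Complexity. $\mathcal F_{\mathrm{CC}}(R_x,R_y,L,\mu_x,\mu_y)$ is the set of $f=\frac1n\sum_{i=1}^nf_i:\mathcal X\times\mathcal Y\to\mathbb R$ (any dimensions $d_x,d_y$) with $\mathrm{diam}(\mathcal X)\le2R_x$,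 $\mathrm{diam}(\mathcal Y)\le2R_y$, $\{f_i\}$ $L$-average smooth and $f$ $(\mu_x,\mu_y)$-convex-concave. Let $\phi_f(x)=\max_{y\in\mathcal Y}f(x,y)$, $\psi_f(y)=\min_{x\in\mathcal X}f(x,y)$. $T(\mathcal A,f,\varepsilon)=\inf\{T\in\mathbb N:\mathbb E\phi_f(x_{\mathcal A,T})-\mathbb E\psi_f(y_{\mathcal A,T})<\varepsilon\}$, where $(x_{\mathcal A,T},y_{\mathcal A,T})$ is the point obtained by $\mathcal A$ at time-step $T-1$. $\mathfrak m^{\mathrm{CC}}(\varepsilon,R_x,R_y,L,\mu_x,\mu_y)=\inf_{\mathcal A\in\mathscr A}\sup_{f\in\mathcal F_{\mathrm{CC}}(R_x,R_y,L,\mu_x,\mu_y)}T(\mathcal A,f,\varepsilon)$. Asymptotic notation. $\Omega(g)$ means at least $c\,g$ with an absolute constant $c>0$ not depending on any problem parameter ($c_0$ being a fixed constant). A case condition $\kappa=\Omega(\sqrt n)$ (resp. $O(\sqrt n)$) means $\kappa\ge c'\sqrt n$ (resp. $\kappa\le c'\sqrt n$) for an absolute constant $c'$. In lower bounds, $\log(1/\varepsilon)$ is shorthand for $\log(s/\varepsilon)$ where the scale $s>0$ may depend on the other parameters but not on $\varepsilon$. *)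

theory Defs
  imports "HOL-Probability.Probability"
begin

text \<open>
  The complexity is a supremum over problems of arbitrary dimensions against one and the same
  algorithm, so the dimension cannot be a type. All the spaces $R^d$ are therefore realised inside
  one inner product space, the finitely supported real sequences, as the subspaces of sequences
  supported on the first d coordinates, with the inherited Euclidean structure.
\<close>

typedef rvec = "{x :: nat \<Rightarrow> real. finite {i. x i \<noteq> 0}}"
  morphisms coord Abs_rvec
  by (rule exI[of _ "\<lambda>_. 0"]) simp

setup_lifting type_definition_rvec

lemma finite_coord: "finite {i. coord x i \<noteq> 0}"
  using coord[of x] by simp

lemma rvec_eqI: "(\<And>i. coord x i = coord y i) \<Longrightarrow> x = y"
  by (simp add: coord_inject[symmetric] fun_eq_iff)

instantiation rvec :: real_vector
begin

lift_definition zero_rvec :: rvec is "\<lambda>_. 0" by simp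

lift_definition plus_rvec :: "rvec \<Rightarrow> rvec \<Rightarrow> rvec" is "\<lambda>x y i. x i + y i"
proof -
  fix x y :: "nat \<Rightarrow> real"
  assume "finite {i. x i \<noteq> 0}" "finite {i. y i \<noteq> 0}"
  then show "finite {i. x i + y i \<noteq> 0}"
    by (rule finite_subset[rotated, OF finite_UnI]) auto
qed

lift_definition uminus_rvec :: "rvec \<Rightarrow> rvec" is "\<lambda>x i. - x i" by simp

lift_definition minus_rvec :: "rvec \<Rightarrow> rvec \<Rightarrow> rvec" is "\<lambda>x y i. x i - y i"
proof -
  fix x y :: "nat \<Rightarrow> real"
  assume "finite {i. x i \<noteq> 0}" "finite {i. y i \<noteq> 0}"
  then show "finite {i. x i - y i \<noteq> 0}"
    by (rule finite_subset[rotated, OF finite_UnI]) auto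
qed

lift_definition scaleR_rvec :: "real \<Rightarrow> rvec \<Rightarrow> rvec" is "\<lambda>r x i. r * x i"
proof -
  fix r :: real and x :: "nat \<Rightarrow> real"
  assume "finite {i. x i \<noteq> 0}"
  then show "finite {i. r * x i \<noteq> 0}"
    by (rule finite_subset[rotated]) auto
qed

instance
  by standard (transfer; simp add: algebra_simps fun_eq_iff)+

end

instantiation rvec :: real_inner
begin

definition inner_rvec :: "rvec \<Rightarrow> rvec \<Rightarrow> real" where
  "inner_rvec x y = (\<Sum>i | coord x i \<noteq> 0. coord x i * coord y i)"

definition norm_rvec :: "rvec \<Rightarrow> real" where
  "norm_rvec x = sqrt (inner x x)"

definition dist_rvec :: "rvec \<Rightarrow> rvec \<Rightarrow> real" where
  "dist_rvec x y = norm (x - y)"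

definition sgn_rvec :: "rvec \<Rightarrow> rvec" where
  "sgn_rvec x = x /\<^sub>R norm x"

definition uniformity_rvec :: "(rvec \<times> rvec) filter" where
  "uniformity_rvec = (INF e\<in>{0<..}. principal {(x, y). dist x y < e})"

definition open_rvec :: "rvec set \<Rightarrow> bool" where
  "open_rvec U \<longleftrightarrow> (\<forall>x\<in>U. eventually (\<lambda>(x', y). x' = x \<longrightarrow> y \<in> U) uniformity)"

lemma inner_rvec_superset:
  assumes "finite S" "{i. coord x i \<noteq> 0} \<subseteq> S"
  shows "inner x y = (\<Sum>i\<in>S. coord x i * coord y i)"
  unfolding inner_rvec_def using assms by (intro sum.mono_neutral_left) auto

instance
proof
  fix x y z :: rvec and r :: real
  let ?S = "{i. coord x i \<noteq> 0} \<union> {i. coord y i \<noteq> 0} \<union> {i. coord z i \<noteq> 0}"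
  have S: "finite ?S"
    by (simp add: finite_coord)
  show "dist x y = norm (x - y)"
    by (simp add: dist_rvec_def)
  show "sgn x = x /\<^sub>R norm x"
    by (simp add: sgn_rvec_def)
  show "inner x y = inner y x"
    by (subst (1 2) inner_rvec_superset[OF S]) (auto simp: mult.commute)
  show "inner (x + y) z = inner x z + inner y z"
    by (subst (1 2 3) inner_rvec_superset[OF S])
      (auto simp: plus_rvec.rep_eq distrib_right sum.distrib)
  show "inner (r *\<^sub>R x) y = r * inner x y"
    by (subst (1 2) inner_rvec_superset[OF S])
      (auto simp: scaleR_rvec.rep_eq sum_distrib_left mult.assoc)
  show "0 \<le> inner x x"
    unfolding inner_rvec_def by (intro sum_nonneg) simp
  show "inner x x = 0 \<longleftrightarrow> x = 0"
  proof
    assume "inner x x = 0"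
    then have "\<forall>i\<in>{i. coord x i \<noteq> 0}. coord x i * coord x i = 0"
      unfolding inner_rvec_def by (subst (asm) sum_nonneg_eq_0_iff) (auto simp: finite_coord)
    then show "x = 0"
      by (intro rvec_eqI) (auto simp: zero_rvec.rep_eq)
  qed (simp add: inner_rvec_def zero_rvec.rep_eq)
  show "norm x = sqrt (inner x x)"
    by (simp add: norm_rvec_def)
qed (simp_all add: uniformity_rvec_def open_rvec_def)

end

definition Rn :: "nat \<Rightarrow> rvec set" where
  "Rn d = {x. \<forall>i\<ge>d. coord x i = 0}"

type_synonym point = "rvec \<times> rvec"


section \<open>Gradients, convexity, projection and proximal points\<close>

text \<open>
  Euclidean gradient of f as a function on the subspace V. For V = Rn dx \<open>\<times>\<close> Rn dy its two
  components are the partial gradients with respect to x and y.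
\<close>

definition gradient :: "point set \<Rightarrow> (point \<Rightarrow> real) \<Rightarrow> point \<Rightarrow> point" where
  "gradient V f z = (THE g. g \<in> V \<and> (f has_derivative (\<lambda>h. g \<bullet> h)) (at z within V))"

definition convex_concave ::
  "real \<Rightarrow> real \<Rightarrow> rvec set \<Rightarrow> rvec set \<Rightarrow> (point \<Rightarrow> real) \<Rightarrow> bool" where
  "convex_concave \<mu>x \<mu>y X Y f \<longleftrightarrow>
     (let F = (\<lambda>x y. f (x, y) - \<mu>x / 2 * (norm x)\<^sup>2 + \<mu>y / 2 * (norm y)\<^sup>2) in
       (\<forall>y\<in>Y. convex_on X (\<lambda>x. F x y)) \<and> (\<forall>x\<in>X. concave_on Y (\<lambda>y. F x y)))"

definition average_smooth ::
  "nat \<Rightarrow> real \<Rightarrow> point set \<Rightarrow> (nat \<Rightarrow> point \<Rightarrow> real) \<Rightarrow> bool" where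
  "average_smooth n L V f \<longleftrightarrow>
     (\<forall>z1\<in>V. \<forall>z2\<in>V.
        (\<Sum>i=1..n. (norm (gradient V (f i) z1 - gradient V (f i) z2))\<^sup>2) / real n
          \<le> L\<^sup>2 * (norm (z1 - z2))\<^sup>2)"

text \<open>
  Same definition as \<open>closest_point\<close>, whose sort constraint \<open>heine_borel\<close> is not satisfied by the
  infinite-dimensional ambient space.
\<close>

definition proj :: "rvec set \<Rightarrow> rvec \<Rightarrow> rvec" where
  "proj S a = (SOME x. x \<in> S \<and> (\<forall>y\<in>S. dist a x \<le> dist a y))"

definition minmax_point :: "rvec set \<Rightarrow> rvec set \<Rightarrow> (point \<Rightarrow> real) \<Rightarrow> point \<Rightarrow> bool" where
  "minmax_point U V F z \<longleftrightarrow>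
     fst z \<in> U \<and> snd z \<in> V \<and>
     (\<forall>u\<in>U. F z \<le> F (u, snd z)) \<and> (\<forall>v\<in>V. F (fst z, v) \<le> F z)"

text \<open>
  The proximal point is available only for \<open>\<gamma> > 0\<close> that make the regularised function
  convex-concave, which is automatic if f is convex-concave.
\<close>

definition prox :: "rvec set \<Rightarrow> rvec set \<Rightarrow> (point \<Rightarrow> real) \<Rightarrow> real \<Rightarrow> point \<Rightarrow> point option" where
  "prox U V f \<gamma> z =
     (let F = (\<lambda>(u, v). f (u, v) + 1 / (2 * \<gamma>) * (norm (fst z - u))\<^sup>2
                                - 1 / (2 * \<gamma>) * (norm (snd z - v))\<^sup>2) in
      if \<gamma> > 0 \<and> convex_concave 0 0 U V F \<and> (\<exists>!w. minmax_point U V F w)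
      then Some (THE w. minmax_point U V F w) else None)"


section \<open>Problems and oracles\<close>

record feasible =
  xdim :: nat
  ydim :: nat
  xset :: "rvec set"
  yset :: "rvec set"

text \<open>The component functions are \<open>comp P 1, \<dots>, comp P n\<close>, seen as functions on
  \<open>Rn (xdim P) \<times> Rn (ydim P)\<close>; this is where the proximal oracle evaluates them.\<close>

record problem = feasible +
  comp :: "nat \<Rightarrow> point \<Rightarrow> real"

definition ambient :: "'a feasible_scheme \<Rightarrow> point set" where
  "ambient P = Rn (xdim P) \<times> Rn (ydim P)"

definition objective :: "nat \<Rightarrow> problem \<Rightarrow> point \<Rightarrow> real" where
  "objective n P z = (\<Sum>i=1..n. comp P i z) / real n"

text \<open>Oracle answers \<open>(f, \<nabla>\<^sub>x f, - \<nabla>\<^sub>y f)\<close>, followed by the proximal point for \<open>pifo\<close>.\<close>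

type_synonym fo_answer = "real \<times> rvec \<times> rvec"
type_synonym pifo_answer = "real \<times> rvec \<times> rvec \<times> point option"

definition fo :: "nat \<Rightarrow> problem \<Rightarrow> point \<Rightarrow> fo_answer" where
  "fo n P z = (let g = gradient (ambient P) (objective n P) z in
     (objective n P z, fst g, - snd g))"

definition pifo :: "problem \<Rightarrow> nat \<Rightarrow> real \<Rightarrow> point \<Rightarrow> pifo_answer" where
  "pifo P i \<gamma> z = (let g = gradient (ambient P) (comp P i) z in
     (comp P i z, fst g, - snd g, prox (Rn (xdim P)) (Rn (ydim P)) (comp P i) \<gamma> z))"


section \<open>PIFO algorithms\<close>

text \<open>
  What has been observed. At the moment of choosing the iterate of step t: \<open>iterates\<close> is
  the list of \<open>(x\<^sub>0, y\<^sub>0), \<dots>, (x\<^bsub>t-1\<^esub>, y\<^bsub>t-1\<^esub>)\<close>; \<open>rounds\<close> holds, for each step \<open>j \<le> t\<close>, the sampled pair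
  \<open>(i\<^sub>j, a\<^sub>j)\<close> and the answers of the PIFO oracle of component \<open>i\<^sub>j\<close> with parameter \<open>\<gamma>\<^sub>j\<close> at all iterates
  of index less than j; \<open>full_answers\<close> holds the answers of the FO oracle of the objective at
  the points of the set H.
\<close>

record round =
  sampled :: nat
  coin :: bool
  answers :: "pifo_answer list"

record history =
  iterates :: "point list"
  rounds :: "round list"
  full_answers :: "fo_answer list"

definition span_generators :: "history \<Rightarrow> point set" where
  "span_generators h =
     set (iterates h) \<union>
     (\<Union>r\<in>set (rounds h). \<Union>(v, gx, gy, p)\<in>set (answers r). {(gx, 0), (0, gy)} \<union> set_option p) \<union>
     (\<Union>(v, gx, gy)\<in>set (full_answers h). {(gx, 0), (0, gy)})"

text \<open>
  An algorithm knows the dimensions and the constraint sets, and accesses the component functions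
  only through the oracle answers. \<open>stepsize\<close> gives \<open>\<gamma>\<^sub>t\<close> from the history of the previous steps and \<open>i\<^sub>t\<close>.
\<close>

record algorithm =
  index_dist :: "nat pmf"
  full_prob :: real
  stepsize :: "feasible \<Rightarrow> history \<Rightarrow> nat \<Rightarrow> real"
  choice :: "feasible \<Rightarrow> history \<Rightarrow> point"

text \<open>
  The span condition is imposed on all histories. This is no loss: a rule can be replaced by 0 on
  histories where it violates the condition, and the generators are part of the history.
\<close>

definition pifo_algorithm :: "real \<Rightarrow> nat \<Rightarrow> algorithm \<Rightarrow> bool" where
  "pifo_algorithm c0 n A \<longleftrightarrow>
     set_pmf (index_dist A) \<subseteq> {1..n} \<and>
     0 < full_prob A \<and> full_prob A \<le> c0 / real n \<and> full_prob A \<le> 1 \<and>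
     (\<forall>D h. choice A D h \<in> span (span_generators h))"

definition start :: "nat \<Rightarrow> problem \<Rightarrow> history" where
  "start n P = \<lparr>iterates = [(0, 0)], rounds = [], full_answers = [fo n P (0, 0)]\<rparr>"

definition step :: "nat \<Rightarrow> algorithm \<Rightarrow> problem \<Rightarrow> history \<Rightarrow> nat \<times> bool \<Rightarrow> history" where
  "step n A P h s =
     (let (i, a) = s;
          D = feasible.truncate P;
          \<gamma> = stepsize A D h i;
          r = \<lparr>sampled = i, coin = a, answers = map (pifo P i \<gamma>) (iterates h)\<rparr>;
          fs = (if a then [fo n P (last (iterates h))] else []);
          h' = h\<lparr>rounds := rounds h @ [r], full_answers := full_answers h @ fs\<rparr>;
          (x, y) = choice A D h'
      in h'\<lparr>iterates := iterates h' @ [(proj (xset P) x, proj (yset P) y)]\<rparr>)"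

text \<open>The point \<open>(x\<^sub>t, y\<^sub>t)\<close> reached after the samples \<open>(i\<^sub>1, a\<^sub>1), \<dots>, (i\<^sub>t, a\<^sub>t)\<close>.\<close>

definition iterate :: "nat \<Rightarrow> algorithm \<Rightarrow> problem \<Rightarrow> (nat \<times> bool) list \<Rightarrow> point" where
  "iterate n A P \<omega> = last (iterates (foldl (step n A P) (start n P) \<omega>))"

definition samples :: "algorithm \<Rightarrow> nat \<Rightarrow> (nat \<times> bool) list pmf" where
  "samples A t = replicate_pmf t (pair_pmf (index_dist A) (bernoulli_pmf (full_prob A)))"


section \<open>Complexity\<close>

definition primal_value :: "nat \<Rightarrow> problem \<Rightarrow> rvec \<Rightarrow> real" where
  "primal_value n P x = (SUP y\<in>yset P. objective n P (x, y))"

definition dual_value :: "nat \<Rightarrow> problem \<Rightarrow> rvec \<Rightarrow> real" where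
  "dual_value n P y = (INF x\<in>xset P. objective n P (x, y))"

definition expected_gap :: "nat \<Rightarrow> algorithm \<Rightarrow> problem \<Rightarrow> nat \<Rightarrow> real" where
  "expected_gap n A P t =
     measure_pmf.expectation (samples A t) (\<lambda>\<omega>. primal_value n P (fst (iterate n A P \<omega>)))
     - measure_pmf.expectation (samples A t) (\<lambda>\<omega>. dual_value n P (snd (iterate n A P \<omega>)))"

text \<open>The point attached to T is the one of time-step T - 1, hence \<open>T \<ge> 1\<close>. The infimum of the empty
  set is \<open>\<infinity>\<close>.\<close>

definition complexity :: "nat \<Rightarrow> algorithm \<Rightarrow> problem \<Rightarrow> real \<Rightarrow> enat" where
  "complexity n A P \<epsilon> = (INF T\<in>{T. 1 \<le> T \<and> expected_gap n A P (T - 1) < \<epsilon>}. enat T)"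

text \<open>
  Boundedness is required explicitly because \<open>diameter\<close> is unspecified on unbounded sets. Note that
  the constraint sets need not contain the starting point 0.
\<close>

definition F_CC :: "nat \<Rightarrow> real \<Rightarrow> real \<Rightarrow> real \<Rightarrow> real \<Rightarrow> real \<Rightarrow> problem set" where
  "F_CC n Rx Ry L \<mu>x \<mu>y = {P.
     0 < xdim P \<and> 0 < ydim P \<and>
     xset P \<subseteq> Rn (xdim P) \<and> xset P \<noteq> {} \<and> closed (xset P) \<and> convex (xset P) \<and>
     yset P \<subseteq> Rn (ydim P) \<and> yset P \<noteq> {} \<and> closed (yset P) \<and> convex (yset P) \<and>
     bounded (xset P) \<and> diameter (xset P) \<le> 2 * Rx \<and>
     bounded (yset P) \<and> diameter (yset P) \<le> 2 * Ry \<and>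
     (\<forall>i\<in>{1..n}. comp P i differentiable_on ambient P) \<and>
     average_smooth n L (ambient P) (comp P) \<and>
     convex_concave \<mu>x \<mu>y (xset P) (yset P) (objective n P)}"

definition m_CC ::
  "real \<Rightarrow> nat \<Rightarrow> real \<Rightarrow> real \<Rightarrow> real \<Rightarrow> real \<Rightarrow> real \<Rightarrow> real \<Rightarrow> enat" where
  "m_CC c0 n \<epsilon> Rx Ry L \<mu>x \<mu>y =
     (INF A\<in>{A. pifo_algorithm c0 n A}. SUP P\<in>F_CC n Rx Ry L \<mu>x \<mu>y. complexity n A P \<epsilon>)"

end

theory Submission
  imports Defs
begin

text \<open>
  An algorithm is forced to uncover a chain of coordinates, the \<^emph>\<open>nodes\<close>, one after another, and the
  saddle point has a coordinate of noticeable size at the far end of the chain.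

  The objective is a quadratic in the nodes \<open>z\<^sub>0, \<dots>, z\<^sub>p\<close> with diagonal terms \<open>d k / 2 * z\<^sub>k\<^sup>2\<close>, links
  \<open>c k * z\<^sub>k * z\<^bsub>k+1\<^esub>\<close> between neighbours and a linear term in \<open>z\<^sub>0\<close>. The finite sum hides the links: one
  component carries all the even links, a second one all the odd links, each multiplied by n, and the
  remaining components share the diagonal and the linear term. Hence only these two components and
  the full gradient can uncover a node, and they uncover at most one per round; distributing the
  links alternately is what stops the proximal map, which is able to run through a connected block of
  links at once. The algorithm commits itself to its sampling distribution before the problem is
  chosen, so the two special components can be the two least likely ones. A round then uncovers a
  node with probability at most \<open>(3 + c0) / n\<close>, and after fewer than about \<open>p * n / (2 * (3 + c0))\<close> rounds
  the expected number of uncovered nodes is at most \<open>p / 2\<close>. While node p is covered, strong convexity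
  keeps the primal-dual gap above \<open>\<mu>x / 2\<close> times the square of the last node of the saddle point. This
  is \<open>m_CC_ge_chain\<close>, resting on \<open>iterate_mem_reach\<close> (covered nodes stay zero), \<open>expected_gap_ge\<close> (the
  probabilistic count) and \<open>gap_ge_quadratic\<close> (the gap seen by the saddle point).

  What remains is to make the nodes of the saddle point decay slowly. The links inside one component
  act on disjoint pairs of nodes, so a link weight w costs only \<open>n\<^sup>2 * w\<^sup>2 / n\<close> in the average smoothness,
  and w may be of the order \<open>L / sqrt n\<close>, while the diagonal may be of the order L.

  \<^item> Alternating primal nodes (curvature \<open>\<mu>x\<close>) and dual nodes (curvature \<open>- \<mu>y\<close>) gives a saddle point that
    decays like \<open>\<theta> ^ k\<close> with \<open>1 / \<theta> - \<theta> = sqrt (\<mu>x * \<mu>y) / w\<close>. About \<open>ln (s / \<epsilon>) * w / sqrt (\<mu>x * \<mu>y)\<close> nodes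
    are visible at accuracy \<open>\<epsilon>\<close>, and n rounds per node add up to \<open>sqrt (\<kappa>x * \<kappa>y * n) * ln (s / \<epsilon>)\<close>.

  \<^item> For a chain of primal nodes only, a path Laplacian of weight w is added to the quadratic form of
    strong convexity. Then \<open>ln (1 / \<theta>)\<close> is at most of the order \<open>sqrt (\<mu>x / w)\<close>. This gives \<open>n powr (3 / 4) * sqrt \<kappa>x * ln (s / \<epsilon>)\<close>.

  \<^item> The same chain with only two nodes gives the linear bound. The set X is a segment far away from
    the origin on which the known node has the constant value \<open>Rx / \<theta>\<close>. This large value compensates for
    the weakness of the link and puts the covered node of the saddle point at \<open>Rx\<close>.

  In the first two regimes these bounds dominate \<open>n * ln (s / \<epsilon>)\<close> up to a constant that depends on \<open>c1\<close>.
  The freedom in the scale s absorbs the rounding of the number of nodes.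
\<close>

section \<open>Coordinates and boxes\<close>

lift_definition unit_rvec :: "nat \<Rightarrow> rvec" is "\<lambda>i j. if j = i then 1 else 0"
  by simp

lift_definition vec_of :: "nat \<Rightarrow> (nat \<Rightarrow> real) \<Rightarrow> rvec" is "\<lambda>d g i. if i < d then g i else 0"
  by (rule finite_subset[of _ "{..<d}" for d]) auto

lift_definition flip :: "nat set \<Rightarrow> rvec \<Rightarrow> rvec" is "\<lambda>S x i. if i \<in> S then - x i else x i"
  by (erule finite_subset[rotated]) auto

lemmas coord_simps [simp] =
  zero_rvec.rep_eq plus_rvec.rep_eq uminus_rvec.rep_eq minus_rvec.rep_eq scaleR_rvec.rep_eq
  unit_rvec.rep_eq vec_of.rep_eq flip.rep_eq

lemma inner_Rn:
  assumes "x \<in> Rn d"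
  shows "x \<bullet> y = (\<Sum>i<d. coord x i * coord y i)"
  using assms by (intro inner_rvec_superset) (auto simp: Rn_def intro: leI)

lemma norm_Rn:
  assumes "x \<in> Rn d"
  shows "(norm x)\<^sup>2 = (\<Sum>i<d. (coord x i)\<^sup>2)"
  unfolding power2_norm_eq_inner using inner_Rn[OF assms, of x] by (simp add: power2_eq_square)

lemma coord_eq_inner: "coord x i = x \<bullet> unit_rvec i"
proof -
  have "unit_rvec i \<bullet> x = (\<Sum>j<Suc i. coord (unit_rvec i) j * coord x j)"
    by (rule inner_Rn) (auto simp: Rn_def)
  also have "\<dots> = (\<Sum>j<Suc i. if j = i then coord x i else 0)"
    by (intro sum.cong) auto
  also have "\<dots> = coord x i"
    by simp
  finally show ?thesis
    by (simp add: inner_commute)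
qed

lemma inner_unit_rvec [simp]: "unit_rvec i \<bullet> unit_rvec j = (if i = j then 1 else 0)"
  using coord_eq_inner[of "unit_rvec i" j] by (auto simp: eq_commute)

lemma subspace_Rn: "subspace (Rn d)"
  by (auto simp: subspace_def Rn_def)

lemma flip_linear [simp]:
  "flip S 0 = 0" "flip S (x - y) = flip S x - flip S y" "flip S (flip S x) = x"
  by (rule rvec_eqI, simp)+

lemma obtain_Rn:
  obtains D where "x \<in> Rn D" "d \<le> D"
proof -
  obtain D where "{i. coord x i \<noteq> 0} \<subseteq> {..<D}"
    using finite_coord[of x] finite_nat_bounded by metis
  then have "x \<in> Rn (max d D)"
    by (fastforce simp: Rn_def)
  then show ?thesis
    using that by simp
qed

lemma norm_flip [simp]: "norm (flip S x) = norm x"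
proof -
  obtain d where x: "x \<in> Rn d"
    by (rule obtain_Rn)
  then have "flip S x \<in> Rn d"
    by (auto simp: Rn_def)
  then have "(norm (flip S x))\<^sup>2 = (norm x)\<^sup>2"
    using x by (simp add: norm_Rn) (intro sum.cong, auto)
  then show ?thesis
    by simp
qed

lemma flip_mem_Rn [simp]: "flip S x \<in> Rn d \<longleftrightarrow> x \<in> Rn d"
  by (auto simp: Rn_def)

text \<open>
  Boxes serve as constraint sets because their projection acts on each coordinate separately.
\<close>
definition coord_box :: "nat \<Rightarrow> (nat \<Rightarrow> real) \<Rightarrow> (nat \<Rightarrow> real) \<Rightarrow> rvec set" where
  "coord_box d c r = {x \<in> Rn d. \<forall>i<d. \<bar>coord x i - c i\<bar> \<le> r i}"

lemma coord_box_subset_Rn: "coord_box d c r \<subseteq> Rn d"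
  by (auto simp: coord_box_def)

lemma convex_coord_box: "convex (coord_box d c r)"
proof -
  have "convex {x. coord x i \<in> {c i - r i .. c i + r i}}" for i
    using convex_linear_vimage[of "\<lambda>x. coord x i" "{c i - r i .. c i + r i}"]
    by (simp add: vimage_def coord_eq_inner bounded_linear.linear bounded_linear_inner_left)
  then have "convex (Rn d \<inter> (\<Inter>i\<in>{..<d}. {x. coord x i \<in> {c i - r i .. c i + r i}}))"
    by (intro convex_Int convex_INT subspace_imp_convex[OF subspace_Rn])
  also have "(Rn d \<inter> (\<Inter>i\<in>{..<d}. {x. coord x i \<in> {c i - r i .. c i + r i}})) = coord_box d c r"
    by (auto simp: coord_box_def abs_le_iff algebra_simps)
  finally show ?thesis .
qed

lemma closed_coord_box: "closed (coord_box d c r)"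
proof -
  have "coord_box d c r = (\<Inter>i\<in>{d..}. {x. coord x i = 0}) \<inter> (\<Inter>i\<in>{..<d}. {x. \<bar>coord x i - c i\<bar> \<le> r i})"
    by (auto simp: coord_box_def Rn_def)
  moreover have "closed {x. coord x i = 0}" "closed {x. \<bar>coord x i - c i\<bar> \<le> r i}" for i
    unfolding coord_eq_inner by (intro closed_Collect_eq closed_Collect_le continuous_intros)+
  ultimately show ?thesis
    by (simp only:) (intro closed_Int closed_INT ballI)
qed

lemma vec_of_mem_box:
  assumes "\<And>i. i < d \<Longrightarrow> \<bar>g i - c i\<bar> \<le> r i"
  shows "vec_of d g \<in> coord_box d c r"
  using assms by (auto simp: coord_box_def Rn_def)

lemma dist_box_le:
  assumes "x \<in> coord_box d c r" "y \<in> coord_box d c r" "(\<Sum>i<d. (r i)\<^sup>2) \<le> R\<^sup>2" "0 \<le> R"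
  shows "dist x y \<le> 2 * R"
proof -
  have "(norm (x - y))\<^sup>2 = (\<Sum>i<d. (coord x i - coord y i)\<^sup>2)"
    using assms subspace_diff[OF subspace_Rn, of x d y] by (subst norm_Rn[of _ d]) (auto simp: coord_box_def)
  also have "\<dots> \<le> (\<Sum>i<d. 4 * (r i)\<^sup>2)"
  proof (intro sum_mono)
    fix i assume "i \<in> {..<d}"
    then have "\<bar>coord x i - c i\<bar> \<le> r i" "\<bar>coord y i - c i\<bar> \<le> r i"
      using assms by (auto simp: coord_box_def)
    then have "\<bar>coord x i - coord y i\<bar> \<le> \<bar>2 * r i\<bar>"
      by linarith
    then have "(coord x i - coord y i)\<^sup>2 \<le> (2 * r i)\<^sup>2"
      by (simp only: abs_le_square_iff)
    then show "(coord x i - coord y i)\<^sup>2 \<le> 4 * (r i)\<^sup>2"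
      by (simp add: power_mult_distrib)
  qed
  also have "\<dots> \<le> (2 * R)\<^sup>2"
    using assms by (simp add: sum_distrib_left[symmetric] power_mult_distrib)
  finally show ?thesis
    unfolding dist_norm by (rule power2_le_imp_le) (use assms in simp)
qed

lemma coord_box_bounded_diameter:
  assumes "coord_box d c r \<noteq> {}" "(\<Sum>i<d. (r i)\<^sup>2) \<le> R\<^sup>2" "0 \<le> R"
  shows "bounded (coord_box d c r)" "diameter (coord_box d c r) \<le> 2 * R"
  using assms dist_box_le[OF _ _ assms(2,3)]
  unfolding bounded_def by (blast, auto simp: dist_norm intro!: diameter_le)

text \<open>
  The projection is a choice among nearest points, so a nearest point has to be exhibited: it is
  obtained by clamping every coordinate.
\<close>
lemma proj_coord_box:
  assumes r: "\<And>i. i < d \<Longrightarrow> 0 \<le> r i"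
  shows "proj (coord_box d c r) a \<in> coord_box d c r"
    and "y \<in> coord_box d c r \<Longrightarrow> dist a (proj (coord_box d c r) a) \<le> dist a y"
proof -
  obtain D where D: "a \<in> Rn D" "d \<le> D"
    by (rule obtain_Rn)
  let ?clamp = "\<lambda>i. max (c i - r i) (min (c i + r i) (coord a i))"
  let ?p = "vec_of d ?clamp"
  have "?p \<in> coord_box d c r"
    using r by (intro vec_of_mem_box) (auto simp: abs_le_iff max_def min_def)
  moreover have "dist a ?p \<le> dist a y" if y: "y \<in> coord_box d c r" for y
  proof -
    have p: "a - ?p \<in> Rn D" "a - y \<in> Rn D"
      using D y by (auto simp: coord_box_def Rn_def)
    have "(coord a i - coord ?p i)\<^sup>2 \<le> (coord a i - coord y i)\<^sup>2" for i
    proof (cases "i < d")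
      case False
      then show ?thesis
        using y by (auto simp: coord_box_def Rn_def)
    next
      case i: True
      have "\<bar>coord y i - c i\<bar> \<le> r i"
        using y i by (auto simp: coord_box_def)
      then have "\<bar>coord a i - coord ?p i\<bar> \<le> \<bar>coord a i - coord y i\<bar>"
        using i by (auto simp: max_def min_def)
      then show ?thesis
        by (simp only: abs_le_square_iff)
    qed
    then have "(norm (a - ?p))\<^sup>2 \<le> (norm (a - y))\<^sup>2"
      unfolding norm_Rn[OF p(1)] norm_Rn[OF p(2)] by (intro sum_mono) simp
    then show ?thesis
      by (simp add: dist_norm)
  qed
  ultimately have "\<exists>w. w \<in> coord_box d c r \<and> (\<forall>y\<in>coord_box d c r. dist a w \<le> dist a y)"
    by blast
  from someI_ex[OF this] show "proj (coord_box d c r) a \<in> coord_box d c r"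
    and "y \<in> coord_box d c r \<Longrightarrow> dist a (proj (coord_box d c r) a) \<le> dist a y"
    unfolding proj_def by blast+
qed

text \<open>
  Erasing a coordinate of the nearest point that vanishes in a and in the centre leaves the box
  invariant and brings the point closer to a.
\<close>
lemma coord_proj_box:
  assumes r: "\<And>i. i < d \<Longrightarrow> 0 \<le> r i" and "coord a j = 0" "c j = 0"
  shows "coord (proj (coord_box d c r) a) j = 0"
proof -
  note w = proj_coord_box[OF r, where c = c and a = a]
  define q where "q = proj (coord_box d c r) a"
  define q' where "q' = q - coord q j *\<^sub>R unit_rvec j"
  have q: "q \<in> coord_box d c r"
    using w q_def by simp
  have "q' \<in> coord_box d c r"
    using q assms(3) r by (fastforce simp: coord_box_def Rn_def q'_def)
  then have "norm (a - q) \<le> norm (a - q')"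
    using w by (simp add: q_def dist_norm)
  then have *: "(norm (a - q))\<^sup>2 \<le> (norm (a - q'))\<^sup>2"
    by simp
  have "(norm (a - q))\<^sup>2 = (norm (a - q'))\<^sup>2 + (coord q j)\<^sup>2"
  proof -
    have "(norm (u - t *\<^sub>R unit_rvec j))\<^sup>2 = (norm u)\<^sup>2 + t\<^sup>2" if "u \<bullet> unit_rvec j = 0" for u t
      using that unfolding power2_norm_eq_inner
      by (simp add: inner_diff_left inner_diff_right inner_commute power2_eq_square)
    moreover have "a - q = (a - q') - coord q j *\<^sub>R unit_rvec j"
      by (simp add: q'_def)
    moreover have "(a - q') \<bullet> unit_rvec j = 0"
      by (simp add: coord_eq_inner[symmetric] q'_def assms)
    ultimately show ?thesis
      by metis
  qed
  then show ?thesis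
    using * q_def by simp
qed

section \<open>Gradients and proximal points\<close>

text \<open>
  Two gradients in V agree because their difference v is itself an admissible direction: along the
  line through z in direction v both predict the same slope.
\<close>
lemma gradient_eqI:
  assumes V: "subspace V" and "z \<in> V" "g \<in> V" and f: "(f has_derivative (\<lambda>h. g \<bullet> h)) (at z within V)"
  shows "gradient V f z = g"
  unfolding gradient_def
proof (rule the_equality)
  show "g \<in> V \<and> (f has_derivative (\<lambda>h. g \<bullet> h)) (at z within V)"
    using assms by simp
next
  fix g' assume g': "g' \<in> V \<and> (f has_derivative (\<lambda>h. g' \<bullet> h)) (at z within V)"
  define v where "v = g' - g"
  have v: "v \<in> V"
    using g' assms subspace_diff by (auto simp: v_def)
  have "((\<lambda>x. f x - f x) has_derivative (\<lambda>h. g' \<bullet> h - g \<bullet> h)) (at z within V)"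
    using g' f by (intro has_derivative_diff) auto
  then have "((\<lambda>x. 0) has_derivative (\<lambda>h. v \<bullet> h)) (at z within V)"
    by (simp add: v_def inner_diff_left)
  then have "((\<lambda>x. 0::real) has_derivative (\<lambda>h. v \<bullet> h))
      (at (z + 0 *\<^sub>R v) within (\<lambda>t::real. z + t *\<^sub>R v) ` UNIV)"
    using has_derivative_subset[of "\<lambda>x. 0::real" "\<lambda>h. v \<bullet> h" z V "range (\<lambda>t::real. z + t *\<^sub>R v)"] v V assms(2)
    by (auto intro: subspace_add subspace_scale)
  moreover have "((\<lambda>t::real. z + t *\<^sub>R v) has_derivative (\<lambda>t. t *\<^sub>R v)) (at 0)"
    by (auto intro!: derivative_eq_intros)
  ultimately have "((\<lambda>t::real. 0::real) has_derivative (\<lambda>t. v \<bullet> (t *\<^sub>R v))) (at 0)"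
    using has_derivative_in_compose[of "\<lambda>t::real. z + t *\<^sub>R v" "\<lambda>t. t *\<^sub>R v" 0 UNIV "\<lambda>x. 0::real" "\<lambda>h. v \<bullet> h"]
    by auto
  then have "(\<lambda>t::real. v \<bullet> (t *\<^sub>R v)) = (\<lambda>t. 0)"
    by (rule has_derivative_unique) (rule has_derivative_const)
  then have "v \<bullet> (1 *\<^sub>R v) = 0"
    by (rule fun_cong)
  then show "g' = g"
    by (simp add: v_def)
qed

text \<open>
  A symmetry of the function that fixes the query point maps saddle points of the regularised
  function to saddle points. The proximal point is the only one, so it is fixed as well. This
  replaces any computation of proximal points.
\<close>
lemma prox_fixed_by_flip:
  assumes inv: "\<And>u v. f (flip S u, flip T v) = f (u, v)"
    and x: "flip S x = x" and y: "flip T y = y"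
    and w: "prox (Rn dx) (Rn dy) f \<gamma> (x, y) = Some w"
  shows "flip S (fst w) = fst w" "flip T (snd w) = snd w"
proof -
  define F where "F = (\<lambda>(u, v). f (u, v) + 1 / (2 * \<gamma>) * (norm (x - u))\<^sup>2 - 1 / (2 * \<gamma>) * (norm (y - v))\<^sup>2)"
  have ex1: "\<exists>!w. minmax_point (Rn dx) (Rn dy) F w" and w: "w = (THE w. minmax_point (Rn dx) (Rn dy) F w)"
    using w by (auto simp: prox_def F_def Let_def split: if_splits)
  have mm: "minmax_point (Rn dx) (Rn dy) F w"
    unfolding w by (rule theI'[OF ex1])
  have "norm (x - flip S u) = norm (x - u)" for u
    using norm_flip[of S "x - u"] x by simp
  moreover have "norm (y - flip T v) = norm (y - v)" for v
    using norm_flip[of T "y - v"] y by simp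
  ultimately have F: "F (flip S u, flip T v) = F (u, v)" for u v
    by (simp add: F_def inv)
  have "minmax_point (Rn dx) (Rn dy) F (flip S (fst w), flip T (snd w))"
    unfolding minmax_point_def
  proof (intro conjI ballI; simp)
    show "fst w \<in> Rn dx" "snd w \<in> Rn dy"
      using mm by (auto simp: minmax_point_def)
    show "F (flip S (fst w), flip T (snd w)) \<le> F (u, flip T (snd w))" if "u \<in> Rn dx" for u
      using mm that F[of "flip S u" "snd w"] F[of "fst w" "snd w"] by (auto simp: minmax_point_def)
    show "F (flip S (fst w), v) \<le> F (flip S (fst w), flip T (snd w))" if "v \<in> Rn dy" for v
      using mm that F[of "fst w" "flip T v"] F[of "fst w" "snd w"] by (auto simp: minmax_point_def)
  qed
  then have "(flip S (fst w), flip T (snd w)) = w"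
    using ex1 mm by blast
  then show "flip S (fst w) = fst w" "flip T (snd w) = snd w"
    by (metis fst_conv, metis snd_conv)
qed

section \<open>Nodes\<close>

text \<open>
  The two placements of the nodes: all of them among the coordinates of x, or alternately in x
  and y, beginning with x.
\<close>
datatype layout = Primal | Alternating

fun node_vec :: "layout \<Rightarrow> nat \<Rightarrow> point" where
  "node_vec Primal k = (unit_rvec k, 0)"
| "node_vec Alternating k =
    (if even k then (unit_rvec (k div 2), 0) else (0, unit_rvec (k div 2)))"

definition node :: "layout \<Rightarrow> point \<Rightarrow> nat \<Rightarrow> real" where
  "node l z k = z \<bullet> node_vec l k"

lemma node_Primal: "node Primal z k = coord (fst z) k"
  by (simp add: node_def coord_eq_inner inner_prod_def)

lemma node_Alternating: "node Alternating z k = coord (if even k then fst z else snd z) (k div 2)"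
  by (simp add: node_def coord_eq_inner inner_prod_def)

lemma node_linear [simp]:
  "node l 0 k = 0" "node l (0, 0) k = 0" "node l (- z) k = - node l z k"
  "node l (z + w) k = node l z k + node l w k" "node l (z - w) k = node l z k - node l w k"
  "node l (r *\<^sub>R z) k = r * node l z k"
  by (simp_all add: node_def inner_add_left inner_diff_left flip: zero_prod_def)

lemma node_vec_orthonormal: "node_vec l j \<bullet> node_vec l k = (if j = k then 1 else 0)"
proof (cases l)
  case Alternating
  have "j = k" if "j div 2 = k div 2" "even j = even k"
    using that by presburger
  then show ?thesis
    using Alternating by (auto simp: inner_prod_def)
qed (simp add: inner_prod_def)

lemma node_node_vec [simp]: "node l (node_vec l j) k = (if j = k then 1 else 0)"
  by (simp add: node_def node_vec_orthonormal)

lemma norm_sum_node_vec: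
  assumes "finite K" "inj_on \<pi> K"
  shows "(norm (\<Sum>k\<in>K. a k *\<^sub>R node_vec l (\<pi> k)))\<^sup>2 = (\<Sum>k\<in>K. (a k)\<^sup>2)"
proof -
  have "norm (node_vec l j) = 1" for j
    using node_vec_orthonormal[of l j j] by (simp add: norm_eq_sqrt_inner)
  moreover have "pairwise (\<lambda>i j. orthogonal (a i *\<^sub>R node_vec l (\<pi> i)) (a j *\<^sub>R node_vec l (\<pi> j))) K"
    using assms(2) by (auto simp: pairwise_def orthogonal_def node_vec_orthonormal inj_on_eq_iff)
  ultimately show ?thesis
    by (subst norm_sum_Pythagorean[OF assms(1)]) (simp_all add: power_mult_distrib)
qed

lemma sum_node_le_norm: "finite K \<Longrightarrow> (\<Sum>k\<in>K. (node l z k)\<^sup>2) \<le> (norm z)\<^sup>2"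
proof -
  assume K: "finite K"
  let ?s = "\<Sum>k\<in>K. node l z k *\<^sub>R node_vec l k"
  have s: "(norm ?s)\<^sup>2 = (\<Sum>k\<in>K. (node l z k)\<^sup>2)"
    using norm_sum_node_vec[OF K, of id] by simp
  have zs: "z \<bullet> ?s = (\<Sum>k\<in>K. (node l z k)\<^sup>2)"
    by (simp add: inner_sum_right node_def power2_eq_square)
  have "0 \<le> (norm (z - ?s))\<^sup>2"
    by simp
  also have "\<dots> = (norm z)\<^sup>2 - 2 * (z \<bullet> ?s) + (norm ?s)\<^sup>2"
    unfolding power2_norm_eq_inner by (simp add: inner_diff_left inner_diff_right inner_commute)
  finally show ?thesis
    using s zs by simp
qed

lemma abs_node_le_norm: "\<bar>node l z k\<bar> \<le> norm z"
  using sum_node_le_norm[of "{k}" l z] by (simp add: abs_le_square_iff[symmetric])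

lemma node_split:
  "node l (x, 0) k = node l (x, y) k \<and> node l (0, y) k = 0 \<or>
   node l (x, 0) k = 0 \<and> node l (0, y) k = node l (x, y) k"
  by (cases l) (auto simp: node_Primal node_Alternating)

definition reach :: "layout \<Rightarrow> nat \<Rightarrow> point set" where
  "reach l k = {z. \<forall>j>k. node l z j = 0}"

lemma subspace_reach: "subspace (reach l k)"
  by (auto simp: subspace_def reach_def)

lemma reach_mono: "k \<le> k' \<Longrightarrow> reach l k \<subseteq> reach l k'"
  by (auto simp: reach_def)

lemma reach_split:
  assumes "(x, y) \<in> reach l k"
  shows "(x, 0) \<in> reach l k" "(0, y) \<in> reach l k"
proof -
  have "node l (x, 0) j = 0 \<and> node l (0, y) j = 0" if "k < j" for j
    using assms that node_split[of l x j y] by (auto simp: reach_def)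
  then show "(x, 0) \<in> reach l k" "(0, y) \<in> reach l k"
    by (auto simp: reach_def)
qed

lemma node_vec_mem_reach: "j \<le> k \<Longrightarrow> node_vec l j \<in> reach l k"
  by (auto simp: reach_def)

text \<open>
  The coordinates of x and of y that hold the nodes after node k. Reflecting exactly these
  coordinates has \<open>reach l k\<close> as its fixed space, see \<open>reach_iff_flip\<close>.
\<close>
fun tail_x :: "layout \<Rightarrow> nat \<Rightarrow> nat set" where
  "tail_x Primal k = {k<..}"
| "tail_x Alternating k = {i. k < 2 * i}"

fun tail_y :: "layout \<Rightarrow> nat \<Rightarrow> nat set" where
  "tail_y Primal k = {}"
| "tail_y Alternating k = {i. k < 2 * i + 1}"

lemma node_flip:
  "node l (flip (tail_x l k) x, flip (tail_y l k) y) j = (if k < j then - 1 else 1) * node l (x, y) j"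
proof (cases l)
  case Alternating
  obtain m where "j = 2 * m \<or> j = Suc (2 * m)"
    using oddE[of j] evenE[of j] by (metis Suc_eq_plus1)
  then show ?thesis
    using Alternating by (auto simp: node_Alternating)
qed (simp add: node_Primal)

lemma reach_iff_flip:
  "(x, y) \<in> reach l k \<longleftrightarrow> flip (tail_x l k) x = x \<and> flip (tail_y l k) y = y"
proof
  assume *: "(x, y) \<in> reach l k"
  show "flip (tail_x l k) x = x \<and> flip (tail_y l k) y = y"
  proof (cases l)
    case Primal
    then show ?thesis
      using * by (auto intro!: rvec_eqI simp: reach_def node_Primal)
  next
    case Alternating
    have "coord x i = 0" if "k < 2 * i" for i
      using * that Alternating by (auto simp: reach_def node_Alternating dest!: spec[of _ "2 * i"])
    moreover have "coord y i = 0" if "k < Suc (2 * i)" for i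
      using * that Alternating by (auto simp: reach_def node_Alternating dest!: spec[of _ "Suc (2 * i)"])
    ultimately show ?thesis
      using Alternating by (auto intro!: rvec_eqI)
  qed
next
  assume "flip (tail_x l k) x = x \<and> flip (tail_y l k) y = y"
  then show "(x, y) \<in> reach l k"
    using node_flip[of l k x y] by (fastforce simp: reach_def split: if_splits)
qed

section \<open>Chain quadratics\<close>

definition chain_quad :: "nat \<Rightarrow> (nat \<Rightarrow> real) \<Rightarrow> (nat \<Rightarrow> real) \<Rightarrow> real \<Rightarrow> (nat \<Rightarrow> real) \<Rightarrow> real" where
  "chain_quad p d c b \<zeta> =
    (\<Sum>k\<le>p. d k / 2 * (\<zeta> k)\<^sup>2) + (\<Sum>k<p. c k * (\<zeta> k * \<zeta> (Suc k))) - b * \<zeta> 0"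

text \<open>
  The derivative of \<open>chain_quad\<close> at \<open>\<zeta>\<close> in direction \<open>\<upsilon>\<close>.
\<close>
definition chain_slope ::
  "nat \<Rightarrow> (nat \<Rightarrow> real) \<Rightarrow> (nat \<Rightarrow> real) \<Rightarrow> real \<Rightarrow> (nat \<Rightarrow> real) \<Rightarrow> (nat \<Rightarrow> real) \<Rightarrow> real" where
  "chain_slope p d c b \<zeta> \<upsilon> =
    (\<Sum>k\<le>p. d k * \<zeta> k * \<upsilon> k) + (\<Sum>k<p. c k * (\<zeta> k * \<upsilon> (Suc k) + \<zeta> (Suc k) * \<upsilon> k)) - b * \<upsilon> 0"

text \<open>
  The exact second-order expansion; the quadratic with \<open>b = 0\<close> is half the Hessian form.
\<close>
lemma chain_quad_add:
  "chain_quad p d c b (\<lambda>k. \<zeta> k + \<upsilon> k) =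
    chain_quad p d c b \<zeta> + chain_slope p d c b \<zeta> \<upsilon> + chain_quad p d c 0 \<upsilon>"
proof -
  have "(\<Sum>k\<le>p. d k / 2 * (\<zeta> k + \<upsilon> k)\<^sup>2) =
      (\<Sum>k\<le>p. d k / 2 * (\<zeta> k)\<^sup>2) + (\<Sum>k\<le>p. d k * \<zeta> k * \<upsilon> k) + (\<Sum>k\<le>p. d k / 2 * (\<upsilon> k)\<^sup>2)"
    unfolding sum.distrib[symmetric] by (intro sum.cong) (auto simp: power2_eq_square field_simps)
  moreover have "(\<Sum>k<p. c k * ((\<zeta> k + \<upsilon> k) * (\<zeta> (Suc k) + \<upsilon> (Suc k)))) =
      (\<Sum>k<p. c k * (\<zeta> k * \<zeta> (Suc k))) + (\<Sum>k<p. c k * (\<zeta> k * \<upsilon> (Suc k) + \<zeta> (Suc k) * \<upsilon> k)) +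
      (\<Sum>k<p. c k * (\<upsilon> k * \<upsilon> (Suc k)))"
    unfolding sum.distrib[symmetric] by (intro sum.cong) (auto simp: algebra_simps)
  ultimately show ?thesis
    by (simp add: chain_quad_def chain_slope_def algebra_simps)
qed

text \<open>
  The deviation from affine behaviour along a segment is the Hessian form of its direction, which
  turns bounds for this form into strong convexity and strong concavity.
\<close>
lemma chain_quad_convex_combination:
  "chain_quad p d c b (\<lambda>k. (1 - t) * \<zeta> k + t * \<upsilon> k) =
    (1 - t) * chain_quad p d c b \<zeta> + t * chain_quad p d c b \<upsilon>
    - t * (1 - t) * chain_quad p d c 0 (\<lambda>k. \<zeta> k - \<upsilon> k)"
proof -
  have "(\<Sum>k\<le>p. d k / 2 * ((1 - t) * \<zeta> k + t * \<upsilon> k)\<^sup>2) =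
      (1 - t) * (\<Sum>k\<le>p. d k / 2 * (\<zeta> k)\<^sup>2) + t * (\<Sum>k\<le>p. d k / 2 * (\<upsilon> k)\<^sup>2)
      - t * (1 - t) * (\<Sum>k\<le>p. d k / 2 * (\<zeta> k - \<upsilon> k)\<^sup>2)"
    unfolding sum.distrib[symmetric] sum_subtractf[symmetric] sum_distrib_left
    by (intro sum.cong) (auto simp: power2_eq_square field_simps)
  moreover have "(\<Sum>k<p. c k * (((1 - t) * \<zeta> k + t * \<upsilon> k) * ((1 - t) * \<zeta> (Suc k) + t * \<upsilon> (Suc k)))) =
      (1 - t) * (\<Sum>k<p. c k * (\<zeta> k * \<zeta> (Suc k))) + t * (\<Sum>k<p. c k * (\<upsilon> k * \<upsilon> (Suc k)))
      - t * (1 - t) * (\<Sum>k<p. c k * ((\<zeta> k - \<upsilon> k) * (\<zeta> (Suc k) - \<upsilon> (Suc k))))"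
    unfolding sum.distrib[symmetric] sum_subtractf[symmetric] sum_distrib_left
    by (intro sum.cong) (auto simp: algebra_simps)
  ultimately show ?thesis
    by (simp add: chain_quad_def algebra_simps)
qed

lemma abs_chain_quad_le:
  assumes "\<And>k. \<bar>\<zeta> k\<bar> \<le> M"
  shows "\<bar>chain_quad p d c b \<zeta>\<bar> \<le> (\<Sum>k\<le>p. \<bar>d k\<bar> / 2 * M\<^sup>2) + (\<Sum>k<p. \<bar>c k\<bar> * (M * M)) + \<bar>b\<bar> * M"
proof -
  have M: "0 \<le> M"
    using assms[of 0] by linarith
  have "\<bar>\<Sum>k\<le>p. d k / 2 * (\<zeta> k)\<^sup>2\<bar> \<le> (\<Sum>k\<le>p. \<bar>d k\<bar> / 2 * M\<^sup>2)"
    using power_mono[OF assms abs_ge_zero, of _ 2]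
    by (intro order_trans[OF sum_abs] sum_mono) (auto simp: abs_mult intro!: mult_left_mono)
  moreover have "\<bar>\<Sum>k<p. c k * (\<zeta> k * \<zeta> (Suc k))\<bar> \<le> (\<Sum>k<p. \<bar>c k\<bar> * (M * M))"
    using assms M by (intro order_trans[OF sum_abs] sum_mono) (auto simp: abs_mult intro!: mult_left_mono mult_mono)
  moreover have "\<bar>b * \<zeta> 0\<bar> \<le> \<bar>b\<bar> * M"
    using assms by (auto simp: abs_mult intro!: mult_left_mono)
  ultimately show ?thesis
    unfolding chain_quad_def by linarith
qed

lemma chain_quad_sum:
  "(\<Sum>i\<in>I. chain_quad p (d i) (c i) (b i) \<zeta>) =
    chain_quad p (\<lambda>k. \<Sum>i\<in>I. d i k) (\<lambda>k. \<Sum>i\<in>I. c i k) (\<Sum>i\<in>I. b i) \<zeta>"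
proof -
  have "(\<Sum>i\<in>I. \<Sum>k\<le>p. d i k / 2 * (\<zeta> k)\<^sup>2) = (\<Sum>k\<le>p. (\<Sum>i\<in>I. d i k) / 2 * (\<zeta> k)\<^sup>2)"
    by (subst sum.swap) (simp add: sum_distrib_right sum_divide_distrib)
  moreover have "(\<Sum>i\<in>I. \<Sum>k<p. c i k * (\<zeta> k * \<zeta> (Suc k))) = (\<Sum>k<p. (\<Sum>i\<in>I. c i k) * (\<zeta> k * \<zeta> (Suc k)))"
    by (subst sum.swap) (simp add: sum_distrib_right)
  ultimately show ?thesis
    unfolding chain_quad_def by (simp add: sum.distrib sum_subtractf sum_distrib_right)
qed

lemma chain_quad_divide:
  "chain_quad p d c b \<zeta> / r = chain_quad p (\<lambda>k. d k / r) (\<lambda>k. c k / r) (b / r) \<zeta>"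
  unfolding chain_quad_def by (simp add: sum_divide_distrib add_divide_distrib diff_divide_distrib mult.commute)

text \<open>
  Stationarity is a three-term recurrence with two boundary conditions. The partial sums of the slope
  telescope: up to node m only the outgoing link of m is left.
\<close>
lemma chain_slope_eq_0:
  assumes "0 < p"
    and first: "d 0 * \<zeta> 0 + c 0 * \<zeta> 1 = b"
    and inner: "\<And>k. Suc k < p \<Longrightarrow> c k * \<zeta> k + d (Suc k) * \<zeta> (Suc k) + c (Suc k) * \<zeta> (Suc (Suc k)) = 0"
    and last: "c (p - 1) * \<zeta> (p - 1) + d p * \<zeta> p = 0"
  shows "chain_slope p d c b \<zeta> \<upsilon> = 0"
proof -
  have *: "(\<Sum>k\<le>m. d k * \<zeta> k * \<upsilon> k) + (\<Sum>k<m. c k * (\<zeta> k * \<upsilon> (Suc k) + \<zeta> (Suc k) * \<upsilon> k))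
      = b * \<upsilon> 0 - c m * \<zeta> (Suc m) * \<upsilon> m" if "m < p" for m
    using that
  proof (induction m)
    case 0
    then show ?case
      using first by (auto simp: algebra_simps)
  next
    case (Suc m)
    have "d (Suc m) * \<zeta> (Suc m) = - (c m * \<zeta> m) - c (Suc m) * \<zeta> (Suc (Suc m))"
      using inner[of m] Suc by linarith
    then have "d (Suc m) * \<zeta> (Suc m) * \<upsilon> (Suc m) = (- (c m * \<zeta> m) - c (Suc m) * \<zeta> (Suc (Suc m))) * \<upsilon> (Suc m)"
      by simp
    then show ?case
      using Suc by (simp add: algebra_simps)
  qed
  obtain m where m: "p = Suc m"
    using assms(1) gr0_implies_Suc by blast
  then have "d p * \<zeta> p = - c m * \<zeta> m"
    using last by simp
  then show ?thesis
    using *[of m] m by (simp add: chain_slope_def algebra_simps)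
qed

definition chain_grad ::
  "layout \<Rightarrow> nat \<Rightarrow> (nat \<Rightarrow> real) \<Rightarrow> (nat \<Rightarrow> real) \<Rightarrow> real \<Rightarrow> (nat \<Rightarrow> real) \<Rightarrow> point" where
  "chain_grad l p d c b \<zeta> =
    (\<Sum>k\<le>p. (d k * \<zeta> k) *\<^sub>R node_vec l k) +
    ((\<Sum>k<p. (c k * \<zeta> k) *\<^sub>R node_vec l (Suc k)) + (\<Sum>k<p. (c k * \<zeta> (Suc k)) *\<^sub>R node_vec l k)) -
    b *\<^sub>R node_vec l 0"

lemma chain_quad_has_derivative:
  "((\<lambda>z. chain_quad p d c b (node l z)) has_derivative (\<lambda>h. chain_grad l p d c b (node l z) \<bullet> h))
    (at z within V)"
proof -
  have node: "((\<lambda>z. node l z k) has_derivative (\<lambda>h. node l h k)) (at z within V)" for k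
    unfolding node_def by (auto intro!: derivative_eq_intros)
  have diag: "((\<lambda>z. d k / 2 * (node l z k)\<^sup>2) has_derivative (\<lambda>h. d k * node l z k * node l h k)) (at z within V)" for k
    by (rule derivative_eq_intros node refl)+ (simp add: fun_eq_iff)
  have link: "((\<lambda>z. c k * (node l z k * node l z (Suc k))) has_derivative
      (\<lambda>h. c k * (node l z k * node l h (Suc k) + node l z (Suc k) * node l h k))) (at z within V)" for k
    by (rule derivative_eq_intros node refl)+ (simp add: fun_eq_iff algebra_simps)
  have root: "((\<lambda>z. b * node l z 0) has_derivative (\<lambda>h. b * node l h 0)) (at z within V)"
    by (rule derivative_eq_intros node refl)+ simp
  have "((\<lambda>z. chain_quad p d c b (node l z)) has_derivative (\<lambda>h. chain_slope p d c b (node l z) (node l h)))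
      (at z within V)"
    unfolding chain_quad_def chain_slope_def
    by (intro has_derivative_add has_derivative_diff has_derivative_sum diag link root)
  moreover have "chain_slope p d c b (node l z) (node l h) = chain_grad l p d c b (node l z) \<bullet> h" for h
  proof -
    have "node l h k = node_vec l k \<bullet> h" for k
      by (simp add: node_def inner_commute)
    then show ?thesis
      unfolding chain_slope_def chain_grad_def
      by (simp add: inner_diff_left inner_add_left inner_sum_left sum.distrib distrib_left mult.assoc)
  qed
  ultimately show ?thesis
    by simp
qed

lemma gradient_chain_quad:
  assumes "subspace V" "z \<in> V" "\<And>k. k \<le> p \<Longrightarrow> node_vec l k \<in> V"
  shows "gradient V (\<lambda>z. chain_quad p d c b (node l z)) z = chain_grad l p d c b (node l z)"
proof -
  have "chain_grad l p d c b (node l z) \<in> V"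
    using assms unfolding chain_grad_def
    by (auto intro!: subspace_add subspace_diff subspace_sum subspace_scale)
  then show ?thesis
    using assms by (intro gradient_eqI chain_quad_has_derivative)
qed

text \<open>
  A gradient step moves information along one link, and not at all when there are no links.
\<close>
lemma chain_grad_mem_reach:
  assumes "z \<in> reach l k"
  shows "chain_grad l p d c b (node l z) \<in> reach l (Suc k)"
    and "(\<And>j. j < p \<Longrightarrow> c j = 0) \<Longrightarrow> chain_grad l p d c b (node l z) \<in> reach l k"
proof -
  have summand: "(a * node l z j) *\<^sub>R node_vec l i \<in> reach l k'" if "i \<le> k' \<or> k < j" for a i j k'
  proof (cases "k < j")
    case True
    then show ?thesis
      using assms subspace_0[OF subspace_reach] by (simp add: reach_def)
  next
    case False
    then show ?thesis
      using that by (intro subspace_scale subspace_reach node_vec_mem_reach) auto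
  qed
  have root: "b *\<^sub>R node_vec l 0 \<in> reach l k'" for k'
    by (intro subspace_scale subspace_reach node_vec_mem_reach) auto
  show "chain_grad l p d c b (node l z) \<in> reach l (Suc k)"
    unfolding chain_grad_def
    by (intro subspace_add subspace_diff subspace_sum subspace_reach summand root) auto
  show "chain_grad l p d c b (node l z) \<in> reach l k" if "\<And>j. j < p \<Longrightarrow> c j = 0"
  proof -
    have "chain_grad l p d c b (node l z) = (\<Sum>k\<le>p. (d k * node l z k) *\<^sub>R node_vec l k) - b *\<^sub>R node_vec l 0"
      using that by (simp add: chain_grad_def)
    also have "\<dots> \<in> reach l k"
      by (intro subspace_diff subspace_sum subspace_reach summand root) auto
    finally show ?thesis .
  qed
qed

lemma chain_grad_diff:
  "chain_grad l p d c b (node l z) - chain_grad l p d c b (node l w) = chain_grad l p d c 0 (node l (z - w))"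
  unfolding chain_grad_def by (simp add: algebra_simps sum_subtractf)

text \<open>
  The assumption separates the diagonal components from the link components. For the latter, the
  contributions to the left and to the right ends of the links are two orthogonal families, whence
  the factor 2.
\<close>
lemma norm_chain_grad_le:
  assumes "(\<forall>k\<le>p. d k = 0) \<or> (\<forall>k<p. c k = 0)"
  shows "(norm (chain_grad l p d c 0 \<upsilon>))\<^sup>2 \<le>
    (\<Sum>k\<le>p. (d k)\<^sup>2 * (\<upsilon> k)\<^sup>2) + 2 * (\<Sum>k<p. (c k)\<^sup>2 * ((\<upsilon> k)\<^sup>2 + (\<upsilon> (Suc k))\<^sup>2))"
  using assms
proof
  assume *: "\<forall>k\<le>p. d k = 0"
  define x y where "x = (\<Sum>k<p. (c k * \<upsilon> k) *\<^sub>R node_vec l (Suc k))"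
    and "y = (\<Sum>k<p. (c k * \<upsilon> (Suc k)) *\<^sub>R node_vec l k)"
  have "(norm (x + y))\<^sup>2 \<le> 2 * (norm x)\<^sup>2 + 2 * (norm y)\<^sup>2"
    using inner_ge_zero[of "x - y"] unfolding power2_norm_eq_inner
    by (simp add: inner_add_left inner_add_right inner_diff_left inner_diff_right inner_commute)
  moreover have "(norm x)\<^sup>2 = (\<Sum>k<p. (c k * \<upsilon> k)\<^sup>2)"
    unfolding x_def by (rule norm_sum_node_vec) auto
  moreover have "(norm y)\<^sup>2 = (\<Sum>k<p. (c k * \<upsilon> (Suc k))\<^sup>2)"
    unfolding y_def using norm_sum_node_vec[of "{..<p}" id] by simp
  moreover have "chain_grad l p d c 0 \<upsilon> = x + y"
    using * by (simp add: chain_grad_def x_def y_def)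
  ultimately show ?thesis
    using * by (simp add: sum.distrib power_mult_distrib distrib_left)
next
  assume *: "\<forall>k<p. c k = 0"
  have "(norm (\<Sum>k\<le>p. (d k * \<upsilon> k) *\<^sub>R node_vec l k))\<^sup>2 = (\<Sum>k\<le>p. (d k * \<upsilon> k)\<^sup>2)"
    using norm_sum_node_vec[of "{..p}" id] by simp
  then show ?thesis
    using * by (simp add: chain_grad_def power_mult_distrib)
qed

text \<open>
  A sign change of all nodes after node k can be felt only by the link between k and k + 1.
\<close>
lemma chain_quad_flip:
  assumes "c k = 0 \<or> p \<le> k"
  shows "chain_quad p d c b (\<lambda>j. (if k < j then - 1 else 1) * \<zeta> j) = chain_quad p d c b \<zeta>"
proof -
  let ?\<sigma> = "\<lambda>j. (if k < j then - 1 else 1) * \<zeta> j"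
  have "c j * (?\<sigma> j * ?\<sigma> (Suc j)) = c j * (\<zeta> j * \<zeta> (Suc j))" if "j < p" for j
    using assms that by (cases "j = k") auto
  moreover have "d j / 2 * (?\<sigma> j)\<^sup>2 = d j / 2 * (\<zeta> j)\<^sup>2" for j
    by simp
  ultimately show ?thesis
    unfolding chain_quad_def by (intro arg_cong2[of _ _ _ _ "(-)"] arg_cong2[of _ _ _ _ "(+)"] sum.cong) auto
qed

text \<open>
  The reflection of the nodes after a missing link is a symmetry, so a proximal step from a point
  in its fixed space stays there.
\<close>
lemma prox_chain_quad_mem_reach:
  assumes "c k = 0 \<or> p \<le> k" "z \<in> reach l k"
    and "prox (Rn dx) (Rn dy) (\<lambda>z. chain_quad p d c b (node l z)) \<gamma> z = Some w"
  shows "w \<in> reach l k"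
proof -
  obtain x y where z: "z = (x, y)"
    by (cases z)
  have "node l (flip (tail_x l k) u, flip (tail_y l k) v) = (\<lambda>j. (if k < j then - 1 else 1) * node l (u, v) j)" for u v
    using node_flip by blast
  then have "chain_quad p d c b (node l (flip (tail_x l k) u, flip (tail_y l k) v)) = chain_quad p d c b (node l (u, v))" for u v
    using chain_quad_flip[of c k p d b "node l (u, v)"] assms(1) by simp
  from prox_fixed_by_flip[of "\<lambda>z. chain_quad p d c b (node l z)", OF this _ _ assms(3)[unfolded z]]
  show ?thesis
    using assms(2) unfolding z by (cases w) (auto simp: reach_iff_flip)
qed

section \<open>The hard problem\<close>

lemma norm_convex_combination:
  "(norm ((1 - t) *\<^sub>R x + t *\<^sub>R y :: 'a :: real_inner))\<^sup>2 =
    (1 - t) * (norm x)\<^sup>2 + t * (norm y)\<^sup>2 - t * (1 - t) * (norm (x - y))\<^sup>2"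
  unfolding power2_norm_eq_inner
  by (simp add: inner_add_left inner_add_right inner_diff_left inner_diff_right inner_commute algebra_simps)

text \<open>
  The components ia and ib receive the links. The box for x is centred at \<open>\<xi>\<close> in its first coordinate,
  which holds node 0, and at 0 elsewhere; so node 0 is the only node that a projection can uncover.
\<close>
locale hidden_chain =
  fixes l :: layout and n p dx dy :: nat and d c :: "nat \<Rightarrow> real" and b :: real
    and ia ib :: nat and \<xi> :: real and rx ry :: "nat \<Rightarrow> real"
  assumes n: "4 \<le> n"
    and ia: "ia \<in> {1..n}" and ib: "ib \<in> {1..n}" and ia_neq_ib: "ia \<noteq> ib"
    and node_vec_ambient: "\<And>k. k \<le> p \<Longrightarrow> node_vec l k \<in> Rn dx \<times> Rn dy"
    and rx: "\<And>i. 0 \<le> rx i" and ry: "\<And>i. 0 \<le> ry i"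
begin

definition "center = (\<lambda>i::nat. if i = 0 then \<xi> else 0)"

definition "X = coord_box dx center rx"

definition "Y = coord_box dy (\<lambda>_. 0) ry"

text \<open>
  The factors are the reciprocals of the fraction of components that carry a term, so that the mean
  over all components restores the coefficients d, c and b.
\<close>
definition diag :: "nat \<Rightarrow> nat \<Rightarrow> real" where
  "diag i k = (if i \<in> {ia, ib} then 0 else real n / real (n - 2) * d k)"

definition link :: "nat \<Rightarrow> nat \<Rightarrow> real" where
  "link i k = (if i = (if even k then ia else ib) then real n * c k else 0)"

definition root :: "nat \<Rightarrow> real" where
  "root i = (if i \<in> {ia, ib} then 0 else real n / real (n - 2) * b)"

definition component :: "nat \<Rightarrow> point \<Rightarrow> real" where
  "component i z = chain_quad p (diag i) (link i) (root i) (node l z)"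

definition P :: problem where
  "P = \<lparr>xdim = dx, ydim = dy, xset = X, yset = Y, comp = component\<rparr>"

lemma P_simps [simp]:
  "xdim P = dx" "ydim P = dy" "xset P = X" "yset P = Y" "comp P = component"
  "ambient P = Rn dx \<times> Rn dy"
  by (simp_all add: P_def ambient_def)

lemma sum_others: "(\<Sum>i=1..n. if i \<in> {ia, ib} then 0 else a) = real (n - 2) * a"
proof -
  have "(\<Sum>i=1..n. if i \<in> {ia, ib} then 0 else a) = (\<Sum>i\<in>{1..n} - {ia, ib}. a)"
    by (intro sum.mono_neutral_cong_right) auto
  also have "card ({1..n} - {ia, ib}) = n - 2"
    using ia ib ia_neq_ib by (subst card_Diff_subset) auto
  ultimately show ?thesis
    by simp
qed

lemma n_pos: "real n > 0" "real (n - 2) > 0"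
  using n by auto

lemma sum_diag: "(\<Sum>i=1..n. diag i k) = real n * d k"
  unfolding diag_def sum_others using n_pos by simp

lemma sum_root: "(\<Sum>i=1..n. root i) = real n * b"
  unfolding root_def sum_others using n_pos by simp

lemma sum_link: "(\<Sum>i=1..n. link i k) = real n * c k"
  unfolding link_def using ia ib by (subst sum.delta) auto

lemma objective_P: "objective n P z = chain_quad p d c b (node l z)"
  unfolding objective_def P_simps component_def chain_quad_sum chain_quad_divide
  using n by (simp only: sum_diag sum_link sum_root) simp

lemma subspace_ambient: "subspace (Rn dx \<times> Rn dy)"
  by (intro subspace_Times subspace_Rn)

lemma gradient_chain:
  assumes "z \<in> Rn dx \<times> Rn dy"
  shows "gradient (Rn dx \<times> Rn dy) (\<lambda>z. chain_quad p d' c' b' (node l z)) z = chain_grad l p d' c' b' (node l z)"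
  using assms by (intro gradient_chain_quad subspace_ambient node_vec_ambient)

lemma gradient_component:
  "z \<in> Rn dx \<times> Rn dy \<Longrightarrow>
    gradient (Rn dx \<times> Rn dy) (component i) z = chain_grad l p (diag i) (link i) (root i) (node l z)"
  using gradient_chain unfolding component_def[abs_def] .

text \<open>
  Relative to \<open>L\<^sup>2\<close>, the diagonal contributes at most \<open>2 * (3 / 5)\<^sup>2\<close>, since \<open>n / (n - 2) \<le> 2\<close>, and the links
  contribute at most \<open>2 * 2 / 100\<close>, since every node is an end of at most two links; the sum is below 1.
\<close>
lemma average_smooth_P:
  assumes d: "\<And>k. k \<le> p \<Longrightarrow> \<bar>d k\<bar> \<le> 3 / 5 * L" and c: "\<And>k. k < p \<Longrightarrow> \<bar>c k\<bar> \<le> L / (10 * sqrt (real n))"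
  shows "average_smooth n L (ambient P) (comp P)"
  unfolding average_smooth_def P_simps
proof (intro ballI)
  fix z w assume z: "z \<in> Rn dx \<times> Rn dy" and w: "w \<in> Rn dx \<times> Rn dy"
  let ?G = "gradient (Rn dx \<times> Rn dy)"
  let ?u = "node l (z - w)"
  have each: "(norm (?G (component i) z - ?G (component i) w))\<^sup>2 \<le>
      (\<Sum>k\<le>p. (diag i k)\<^sup>2 * (?u k)\<^sup>2) + 2 * (\<Sum>k<p. (link i k)\<^sup>2 * ((?u k)\<^sup>2 + (?u (Suc k))\<^sup>2))" for i
    unfolding gradient_component[OF z] gradient_component[OF w] chain_grad_diff
    by (rule norm_chain_grad_le) (auto simp: diag_def link_def)
  have sd: "(\<Sum>i=1..n. (diag i k)\<^sup>2) \<le> real n * (18 / 25 * L\<^sup>2)" if "k \<le> p" for k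
  proof -
    have "(\<Sum>i=1..n. (diag i k)\<^sup>2) = (\<Sum>i=1..n. if i \<in> {ia, ib} then 0 else (real n / real (n - 2) * d k)\<^sup>2)"
      by (intro sum.cong) (auto simp: diag_def)
    also have "\<dots> = real n * (real n / real (n - 2) * (d k)\<^sup>2)"
      unfolding sum_others using n_pos(2) by (simp del: of_nat_diff add: power2_eq_square)
    also have "\<dots> \<le> real n * (2 * (3 / 5 * L)\<^sup>2)"
    proof (intro mult_left_mono mult_mono)
      show "real n / real (n - 2) \<le> 2"
        using n by (simp add: divide_le_eq of_nat_diff)
      show "(d k)\<^sup>2 \<le> (3 / 5 * L)\<^sup>2"
        using d[OF that] by (meson abs_le_square_iff abs_ge_self order_trans)
    qed auto
    finally show ?thesis
      by (simp add: power2_eq_square)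
  qed
  have sl: "(\<Sum>i=1..n. (link i k)\<^sup>2) \<le> real n * (L\<^sup>2 / 100)" if "k < p" for k
  proof -
    have "(\<Sum>i=1..n. (link i k)\<^sup>2) = (\<Sum>i=1..n. if i = (if even k then ia else ib) then (real n * c k)\<^sup>2 else 0)"
      by (intro sum.cong) (auto simp: link_def)
    also have "\<dots> = (real n)\<^sup>2 * (c k)\<^sup>2"
      using ia ib by (subst sum.delta) (auto simp: power_mult_distrib)
    also have "\<dots> \<le> (real n)\<^sup>2 * (L / (10 * sqrt (real n)))\<^sup>2"
      using c[OF that] by (intro mult_left_mono) (meson abs_le_square_iff abs_ge_self order_trans, simp)
    also have "\<dots> = real n * (L\<^sup>2 / 100)"
      using n_pos by (simp add: power_divide power_mult_distrib power2_eq_square)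
    finally show ?thesis .
  qed
  have "(\<Sum>i=1..n. (norm (?G (component i) z - ?G (component i) w))\<^sup>2) \<le>
      (\<Sum>i=1..n. (\<Sum>k\<le>p. (diag i k)\<^sup>2 * (?u k)\<^sup>2) + 2 * (\<Sum>k<p. (link i k)\<^sup>2 * ((?u k)\<^sup>2 + (?u (Suc k))\<^sup>2)))"
    by (intro sum_mono each)
  also have "\<dots> = (\<Sum>k\<le>p. (\<Sum>i=1..n. (diag i k)\<^sup>2) * (?u k)\<^sup>2) +
      2 * (\<Sum>k<p. (\<Sum>i=1..n. (link i k)\<^sup>2) * ((?u k)\<^sup>2 + (?u (Suc k))\<^sup>2))"
    unfolding sum.distrib sum_distrib_left[symmetric] sum_distrib_right
    by (intro arg_cong2[of _ _ _ _ "(+)"] arg_cong[of _ _ "\<lambda>x. 2 * x"] sum.swap)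
  also have "\<dots> \<le> (\<Sum>k\<le>p. real n * (18 / 25 * L\<^sup>2) * (?u k)\<^sup>2) +
      2 * (\<Sum>k<p. real n * (L\<^sup>2 / 100) * ((?u k)\<^sup>2 + (?u (Suc k))\<^sup>2))"
    using sd sl by (intro add_mono mult_left_mono sum_mono mult_right_mono) auto
  also have "\<dots> = real n * L\<^sup>2 * (18 / 25 * (\<Sum>k\<le>p. (?u k)\<^sup>2) +
      1 / 50 * ((\<Sum>k<p. (?u k)\<^sup>2) + (\<Sum>k<p. (?u (Suc k))\<^sup>2)))"
    unfolding sum.distrib[symmetric] by (simp add: sum_distrib_left algebra_simps)
  also have "\<dots> \<le> real n * L\<^sup>2 * (18 / 25 * (norm (z - w))\<^sup>2 + 1 / 50 * ((norm (z - w))\<^sup>2 + (norm (z - w))\<^sup>2))"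
  proof (intro mult_left_mono add_mono)
    have "(\<Sum>k<p. (?u (Suc k))\<^sup>2) = (\<Sum>k\<in>Suc ` {..<p}. (?u k)\<^sup>2)"
      by (simp add: sum.reindex)
    then show "(\<Sum>k<p. (?u (Suc k))\<^sup>2) \<le> (norm (z - w))\<^sup>2"
      using sum_node_le_norm[of "Suc ` {..<p}" l "z - w"] by simp
  qed (auto simp del: node_linear intro!: sum_node_le_norm)
  also have "\<dots> \<le> real n * (L\<^sup>2 * (norm (z - w))\<^sup>2)"
    by (simp add: algebra_simps mult_left_mono)
  finally show "(\<Sum>i=1..n. (norm (?G (component i) z - ?G (component i) w))\<^sup>2) / real n \<le> L\<^sup>2 * (norm (z - w))\<^sup>2"
    using n_pos by (simp add: divide_le_eq mult.commute)
qed

lemma objective_convex_combination: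
  "objective n P ((1 - t) *\<^sub>R z + t *\<^sub>R w) =
    (1 - t) * objective n P z + t * objective n P w - t * (1 - t) * chain_quad p d c 0 (node l (z - w))"
proof -
  have "node l ((1 - t) *\<^sub>R z + t *\<^sub>R w) = (\<lambda>k. (1 - t) * node l z k + t * node l w k)"
    "node l (z - w) = (\<lambda>k. node l z k - node l w k)"
    by auto
  then show ?thesis
    unfolding objective_P using chain_quad_convex_combination by simp
qed

lemma convex_concave_P:
  assumes x: "\<And>x x'. x \<in> X \<Longrightarrow> x' \<in> X \<Longrightarrow> \<mu>x / 2 * (norm (x - x'))\<^sup>2 \<le> chain_quad p d c 0 (node l (x - x', 0))"
    and y: "\<And>y y'. y \<in> Y \<Longrightarrow> y' \<in> Y \<Longrightarrow> chain_quad p d c 0 (node l (0, y - y')) \<le> - (\<mu>y / 2) * (norm (y - y'))\<^sup>2"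
  shows "convex_concave \<mu>x \<mu>y X Y (objective n P)"
proof -
  have step: "o' - \<mu> * ((1 - t) * m + t * m' - t * (1 - t) * N) + q \<le> (1 - t) * (a - \<mu> * m + q) + t * (a' - \<mu> * m' + q)"
    if "o' \<le> (1 - t) * a + t * a' - t * (1 - t) * (\<mu> * N)" for o' \<mu> t m m' N q a a' :: real
    using that by (simp add: algebra_simps)
  have step': "- (o' - q + \<mu> * ((1 - t) * m + t * m' - t * (1 - t) * N)) \<le> (1 - t) * - (a - q + \<mu> * m) + t * - (a' - q + \<mu> * m')"
    if "- o' \<le> (1 - t) * - a + t * - a' - t * (1 - t) * (\<mu> * N)" for o' \<mu> t m m' N q a a' :: real
    using that by (simp add: algebra_simps)
  show ?thesis
    unfolding convex_concave_def Let_def concave_on_def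
  proof (intro conjI ballI convex_onI)
    fix t :: real and y x x' assume t: "0 < t" "t < 1" and xs: "x \<in> X" "x' \<in> X"
    have "objective n P ((1 - t) *\<^sub>R x + t *\<^sub>R x', y) = objective n P ((1 - t) *\<^sub>R (x, y) + t *\<^sub>R (x', y))"
      by (simp add: algebra_simps)
    also have "\<dots> = (1 - t) * objective n P (x, y) + t * objective n P (x', y) - t * (1 - t) * chain_quad p d c 0 (node l (x - x', 0))"
      unfolding objective_convex_combination by simp
    also have "\<dots> \<le> (1 - t) * objective n P (x, y) + t * objective n P (x', y) - t * (1 - t) * (\<mu>x / 2 * (norm (x - x'))\<^sup>2)"
      using t x[OF xs] by (auto intro!: mult_left_mono)
    finally have "objective n P ((1 - t) *\<^sub>R x + t *\<^sub>R x', y) \<le>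
      (1 - t) * objective n P (x, y) + t * objective n P (x', y) - t * (1 - t) * (\<mu>x / 2 * (norm (x - x'))\<^sup>2)" .
    from step[OF this] show "objective n P ((1 - t) *\<^sub>R x + t *\<^sub>R x', y) - \<mu>x / 2 * (norm ((1 - t) *\<^sub>R x + t *\<^sub>R x'))\<^sup>2 + \<mu>y / 2 * (norm y)\<^sup>2
      \<le> (1 - t) * (objective n P (x, y) - \<mu>x / 2 * (norm x)\<^sup>2 + \<mu>y / 2 * (norm y)\<^sup>2) +
        t * (objective n P (x', y) - \<mu>x / 2 * (norm x')\<^sup>2 + \<mu>y / 2 * (norm y)\<^sup>2)"
      unfolding norm_convex_combination .
  next
    fix t :: real and x y y' assume t: "0 < t" "t < 1" and ys: "y \<in> Y" "y' \<in> Y"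
    have "- objective n P (x, (1 - t) *\<^sub>R y + t *\<^sub>R y') = - objective n P ((1 - t) *\<^sub>R (x, y) + t *\<^sub>R (x, y'))"
      by (simp add: algebra_simps)
    also have "\<dots> = - ((1 - t) * objective n P (x, y) + t * objective n P (x, y') - t * (1 - t) * chain_quad p d c 0 (node l (0, y - y')))"
      unfolding objective_convex_combination by simp
    also have "\<dots> \<le> (1 - t) * - objective n P (x, y) + t * - objective n P (x, y') - t * (1 - t) * (\<mu>y / 2 * (norm (y - y'))\<^sup>2)"
      using mult_left_mono[OF y[OF ys], of "t * (1 - t)"] t by simp
    finally have "- objective n P (x, (1 - t) *\<^sub>R y + t *\<^sub>R y') \<le>
      (1 - t) * - objective n P (x, y) + t * - objective n P (x, y') - t * (1 - t) * (\<mu>y / 2 * (norm (y - y'))\<^sup>2)" .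
    from step'[OF this] show "- (objective n P (x, (1 - t) *\<^sub>R y + t *\<^sub>R y') - \<mu>x / 2 * (norm x)\<^sup>2 + \<mu>y / 2 * (norm ((1 - t) *\<^sub>R y + t *\<^sub>R y'))\<^sup>2)
      \<le> (1 - t) * - (objective n P (x, y) - \<mu>x / 2 * (norm x)\<^sup>2 + \<mu>y / 2 * (norm y)\<^sup>2) +
        t * - (objective n P (x, y') - \<mu>x / 2 * (norm x)\<^sup>2 + \<mu>y / 2 * (norm y')\<^sup>2)"
      unfolding norm_convex_combination .
  qed (simp_all add: X_def Y_def convex_coord_box)
qed

lemma X_nonempty: "X \<noteq> {}" and Y_nonempty: "Y \<noteq> {}"
  using vec_of_mem_box[of dx center center rx] vec_of_mem_box[of dy "\<lambda>_. 0" "\<lambda>_. 0" ry] rx ry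
  by (auto simp: X_def Y_def)

lemma P_in_F_CC:
  assumes "0 < dx" "0 < dy"
    and "\<And>k. k \<le> p \<Longrightarrow> \<bar>d k\<bar> \<le> 3 / 5 * L" "\<And>k. k < p \<Longrightarrow> \<bar>c k\<bar> \<le> L / (10 * sqrt (real n))"
    and "0 \<le> Rx" "0 \<le> Ry" "(\<Sum>i<dx. (rx i)\<^sup>2) \<le> Rx\<^sup>2" "(\<Sum>i<dy. (ry i)\<^sup>2) \<le> Ry\<^sup>2"
    and "\<And>x x'. x \<in> X \<Longrightarrow> x' \<in> X \<Longrightarrow> \<mu>x / 2 * (norm (x - x'))\<^sup>2 \<le> chain_quad p d c 0 (node l (x - x', 0))"
    and "\<And>y y'. y \<in> Y \<Longrightarrow> y' \<in> Y \<Longrightarrow> chain_quad p d c 0 (node l (0, y - y')) \<le> - (\<mu>y / 2) * (norm (y - y'))\<^sup>2"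
  shows "P \<in> F_CC n Rx Ry L \<mu>x \<mu>y"
proof -
  have "component i differentiable_on Rn dx \<times> Rn dy" for i
    unfolding component_def[abs_def] differentiable_on_def differentiable_def
    using chain_quad_has_derivative by blast
  then show ?thesis
    unfolding F_CC_def
    using assms average_smooth_P[of L] convex_concave_P[of \<mu>x \<mu>y] X_nonempty Y_nonempty
      coord_box_bounded_diameter[of dx center rx Rx] coord_box_bounded_diameter[of dy "\<lambda>_. 0" ry Ry]
    by (simp add: X_def[symmetric] Y_def[symmetric])
      (simp add: X_def Y_def coord_box_subset_Rn closed_coord_box convex_coord_box)
qed

lemma objective_bounded:
  assumes "bounded S"
  shows "\<exists>B. \<forall>z\<in>S. \<bar>objective n P z\<bar> \<le> B"
proof -
  obtain M where M: "\<And>z. z \<in> S \<Longrightarrow> norm z \<le> M"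
    using assms by (auto simp: bounded_iff)
  have "\<bar>objective n P z\<bar> \<le> (\<Sum>k\<le>p. \<bar>d k\<bar> / 2 * M\<^sup>2) + (\<Sum>k<p. \<bar>c k\<bar> * (M * M)) + \<bar>b\<bar> * M" if "z \<in> S" for z
    unfolding objective_P using M[OF that] abs_node_le_norm[of l z]
    by (intro abs_chain_quad_le) (meson order_trans)
  then show ?thesis
    by blast
qed

lemma bounded_X: "bounded X" and bounded_Y: "bounded Y"
proof -
  have le: "(\<Sum>i<m. (r i)\<^sup>2) \<le> (sqrt (\<Sum>i<m. (r i)\<^sup>2))\<^sup>2" for m and r :: "nat \<Rightarrow> real"
    by (simp add: sum_nonneg)
  show "bounded X" "bounded Y"
    using coord_box_bounded_diameter(1)[OF _ le] X_nonempty Y_nonempty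
    by (auto simp: X_def Y_def sum_nonneg)
qed

text \<open>
  Boundedness is needed for the supremum and the infimum in the primal and dual values to dominate
  the values at the test points.
\<close>
lemma gap_ge_test_points:
  assumes "xs \<in> X" "ys \<in> Y"
  shows "objective n P (x, ys) - objective n P (xs, y) \<le> primal_value n P x - dual_value n P y"
proof -
  have "bounded ({x} \<times> Y)" "bounded (X \<times> {y})"
    using bounded_X bounded_Y by (auto intro!: bounded_Times)
  then obtain A B where A: "\<And>y. y \<in> Y \<Longrightarrow> \<bar>objective n P (x, y)\<bar> \<le> A" and B: "\<And>x. x \<in> X \<Longrightarrow> \<bar>objective n P (x, y)\<bar> \<le> B"
    using objective_bounded by (metis SigmaI singletonI)
  have "objective n P (x, ys) \<le> primal_value n P x"
    unfolding primal_value_def P_simps using A assms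
    by (intro cSUP_upper bdd_aboveI2[of _ _ A]) (auto simp: abs_le_iff)
  moreover have "dual_value n P y \<le> objective n P (xs, y)"
    unfolding dual_value_def P_simps using B assms
    by (intro cINF_lower bdd_belowI2[of _ "- B"]) (auto simp: abs_le_iff minus_le_iff)
  ultimately show ?thesis
    by linarith
qed

text \<open>
  With a saddle point as test point the first-order terms of both expansions vanish. The bound holds
  for arbitrary x and y, which includes a starting point outside the constraint sets.
\<close>
lemma gap_ge_quadratic:
  assumes "xs \<in> X" "ys \<in> Y" and stationary: "\<And>\<upsilon>. chain_slope p d c b (node l (xs, ys)) \<upsilon> = 0"
  shows "chain_quad p d c 0 (node l (x - xs, 0)) - chain_quad p d c 0 (node l (0, y - ys))
    \<le> primal_value n P x - dual_value n P y"
proof -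
  have *: "objective n P z = objective n P (xs, ys) + chain_quad p d c 0 (node l (z - (xs, ys)))" for z
  proof -
    have "node l z = (\<lambda>k. node l (xs, ys) k + node l (z - (xs, ys)) k)"
      by auto
    then show ?thesis
      unfolding objective_P using chain_quad_add[of p d c b "node l (xs, ys)" "node l (z - (xs, ys))"] stationary
      by simp
  qed
  show ?thesis
    using gap_ge_test_points[OF assms(1,2), of x y] *[of "(x, ys)"] *[of "(xs, y)"] by simp
qed

section \<open>Confinement of the iterates\<close>

text \<open>
  The rounds that may uncover a node.
\<close>
definition lucky :: "nat \<times> bool \<Rightarrow> bool" where
  "lucky s \<longleftrightarrow> fst s \<in> {ia, ib} \<or> snd s"

text \<open>
  The invariant of a run. The iterates include the origin, which lies in Y but not always in X; this
  is why only their second components are required to be feasible.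
\<close>
definition confined :: "nat \<Rightarrow> history \<Rightarrow> bool" where
  "confined k h \<longleftrightarrow> iterates h \<noteq> [] \<and> set (iterates h) \<subseteq> (Rn dx \<times> Y) \<inter> reach l k \<and>
    span_generators h \<subseteq> reach l k"

lemma proj_mem_reach:
  assumes "(x, y) \<in> reach l k"
  shows "(proj X x, proj Y y) \<in> (Rn dx \<times> Y) \<inter> reach l k"
proof -
  have *: "coord (proj X x) i = 0" if "coord x i = 0" "0 < i" for i
    unfolding X_def using that rx by (intro coord_proj_box) (auto simp: center_def)
  have **: "coord (proj Y y) i = 0" if "coord y i = 0" for i
    unfolding Y_def using that ry by (intro coord_proj_box) auto
  have "node l (proj X x, proj Y y) j = 0" if "k < j" for j
  proof -
    obtain m where "j = 2 * m \<or> j = Suc (2 * m)"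
      using oddE[of j] evenE[of j] by (metis Suc_eq_plus1)
    moreover have "node l (x, y) j = 0" "0 < j"
      using assms \<open>k < j\<close> by (auto simp: reach_def)
    ultimately show ?thesis
      using * ** by (cases l) (auto simp: node_Primal node_Alternating)
  qed
  moreover have "proj X x \<in> X" "proj Y y \<in> Y"
    unfolding X_def Y_def using rx ry by (auto intro!: proj_coord_box)
  then have "proj X x \<in> Rn dx" "proj Y y \<in> Y"
    unfolding X_def using coord_box_subset_Rn by blast+
  ultimately show ?thesis
    by (auto simp: reach_def)
qed

lemma Y_subset: "Y \<subseteq> Rn dy"
  by (simp add: Y_def coord_box_subset_Rn)

lemma gradient_answers_mem_reach:
  assumes "g \<in> reach l k"
  shows "(fst g, 0) \<in> reach l k" "(0, - snd g) \<in> reach l k"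
  using reach_split[of "fst g" "snd g" l k] subspace_neg[OF subspace_reach, of "(0, snd g)" l k] assms
  by simp_all

text \<open>
  Neither ia nor ib has two consecutive links. So if the component has a link at node k, it has none
  at node k + 1, and its proximal map cannot pass beyond that node.
\<close>
lemma component_answers_mem_reach:
  assumes z: "z \<in> (Rn dx \<times> Rn dy) \<inter> reach l k"
    and k': "k' = (if i \<in> {ia, ib} then Suc k else k)"
    and "pifo P i \<gamma> z = (v, gx, gy, w)"
  shows "{(gx, 0), (0, gy)} \<union> set_option w \<subseteq> reach l k'"
proof -
  let ?g = "gradient (Rn dx \<times> Rn dy) (component i) z"
  have other: "link i j = 0" if "i \<notin> {ia, ib}" for j
    using that by (auto simp: link_def)
  have "?g \<in> reach l k'"
    using z k' other by (auto simp: gradient_component intro!: chain_grad_mem_reach)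
  moreover have "gx = fst ?g" "gy = - snd ?g" "w = prox (Rn dx) (Rn dy) (component i) \<gamma> z"
    using assms(3) by (auto simp: pifo_def Let_def)
  moreover have "u \<in> reach l k'" if u: "prox (Rn dx) (Rn dy) (component i) \<gamma> z = Some u" for u
  proof -
    \<comment> \<open>the first node from k on behind which the component has no link\<close>
    obtain j where j: "k \<le> j" "j \<le> k'" "link i j = 0"
    proof (cases "link i k = 0")
      case True
      then show ?thesis
        using that[of k] k' by auto
    next
      case False
      then have "link i (Suc k) = 0" "i \<in> {ia, ib}"
        using ia_neq_ib by (auto simp: link_def split: if_splits)
      then show ?thesis
        using that[of "Suc k"] k' by auto
    qed
    have "u \<in> reach l j"
      using u unfolding component_def[abs_def]
      by (rule prox_chain_quad_mem_reach[rotated 2]) (use z j reach_mono[of k j l] in auto)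
    then show ?thesis
      using reach_mono[OF j(2)] by blast
  qed
  ultimately show ?thesis
    using gradient_answers_mem_reach[of ?g k'] by auto
qed

text \<open>
  The full gradient uses all links, but moves along each only once. The gradient at the origin is part
  of the initial information and consists of the linear term alone, which lives at node 0.
\<close>
lemma full_answers_mem_reach:
  assumes z: "z \<in> Rn dx \<times> Rn dy" and "fo n P z = (v, gx, gy)"
  shows "z \<in> reach l k \<Longrightarrow> {(gx, 0), (0, gy)} \<subseteq> reach l (Suc k)"
    and "z = (0, 0) \<Longrightarrow> {(gx, 0), (0, gy)} \<subseteq> reach l 0"
proof -
  let ?g = "chain_grad l p d c b (node l z)"
  have "gradient (Rn dx \<times> Rn dy) (objective n P) z = ?g"
    using gradient_chain[OF z, of d c b] by (simp add: objective_P[abs_def])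
  then have g: "gx = fst ?g" "gy = - snd ?g"
    using assms(2) by (auto simp: fo_def Let_def)
  show "{(gx, 0), (0, gy)} \<subseteq> reach l (Suc k)" if "z \<in> reach l k"
    unfolding g using gradient_answers_mem_reach[OF chain_grad_mem_reach(1)[OF that]] by simp
  show "{(gx, 0), (0, gy)} \<subseteq> reach l 0" if "z = (0, 0)"
  proof -
    have "?g = - b *\<^sub>R node_vec l 0"
      using that by (simp add: chain_grad_def)
    also have "\<dots> \<in> reach l 0"
      by (intro subspace_scale subspace_reach node_vec_mem_reach) simp
    finally show ?thesis
      unfolding g using gradient_answers_mem_reach by simp
  qed
qed

lemma confined_start: "confined 0 (start n P)"
proof -
  obtain v gx gy where fo: "fo n P (0, 0) = (v, gx, gy)"
    by (cases "fo n P (0, 0)")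
  have "(0, 0) \<in> Rn dx \<times> Y" "(0, 0) \<in> Rn dx \<times> Rn dy" "(0, 0) \<in> reach l 0"
    using ry by (auto simp: Rn_def reach_def Y_def coord_box_def)
  then show ?thesis
    using full_answers_mem_reach(2)[OF _ fo] by (simp add: confined_def start_def span_generators_def fo)
qed

lemma confined_step:
  assumes A: "pifo_algorithm c0 n A" and h: "confined k h"
  shows "confined (if lucky s then Suc k else k) (step n A P h s)"
proof -
  obtain i a where s: "s = (i, a)"
    by (cases s)
  define k' where "k' = (if lucky s then Suc k else k)"
  define \<gamma> where "\<gamma> = stepsize A (feasible.truncate P) h i"
  define r where "r = \<lparr>sampled = i, coin = a, answers = map (pifo P i \<gamma>) (iterates h)\<rparr>"
  define fs where "fs = (if a then [fo n P (last (iterates h))] else [])"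
  define h' where "h' = h\<lparr>rounds := rounds h @ [r], full_answers := full_answers h @ fs\<rparr>"
  obtain x y where xy: "choice A (feasible.truncate P) h' = (x, y)"
    by (cases "choice A (feasible.truncate P) h'")
  have step: "step n A P h s = h'\<lparr>iterates := iterates h' @ [(proj X x, proj Y y)]\<rparr>"
    using xy unfolding step_def s h'_def fs_def r_def \<gamma>_def by (simp add: Let_def)
  have le: "reach l k \<subseteq> reach l k'"
    by (intro reach_mono) (simp add: k'_def)
  have z: "z \<in> (Rn dx \<times> Rn dy) \<inter> reach l k" if "z \<in> set (iterates h)" for z
    using h that Y_subset by (auto simp: confined_def)
  have new_round: "{(gx, 0), (0, gy)} \<union> set_option w \<subseteq> reach l k'"
    if *: "(v, gx, gy, w) \<in> set (answers r)" for v gx gy w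
  proof -
    obtain z' where z': "z' \<in> set (iterates h)" "pifo P i \<gamma> z' = (v, gx, gy, w)"
      using * by (auto simp: r_def)
    have "{(gx, 0), (0, gy)} \<union> set_option w \<subseteq> reach l (if i \<in> {ia, ib} then Suc k else k)"
      by (rule component_answers_mem_reach[OF z[OF z'(1)] refl z'(2)])
    also have "\<dots> \<subseteq> reach l k'"
      by (intro reach_mono) (auto simp: k'_def lucky_def s)
    finally show ?thesis .
  qed
  have new_full: "{(gx, 0), (0, gy)} \<subseteq> reach l k'" if "(v, gx, gy) \<in> set fs" for v gx gy
  proof -
    have a: "a" and fo: "fo n P (last (iterates h)) = (v, gx, gy)"
      using that by (auto simp: fs_def split: if_splits)
    have "last (iterates h) \<in> set (iterates h)"
      using h by (simp add: confined_def)
    then show ?thesis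
      using full_answers_mem_reach(1)[OF _ fo, of k] z a by (simp add: k'_def lucky_def s)
  qed
  have old: "span_generators h \<subseteq> reach l k'"
    using h le by (auto simp: confined_def)
  have "span_generators h' = span_generators h \<union>
      (\<Union>(v, gx, gy, w)\<in>set (answers r). {(gx, 0), (0, gy)} \<union> set_option w) \<union>
      (\<Union>(v, gx, gy)\<in>set fs. {(gx, 0), (0, gy)})"
    unfolding span_generators_def h'_def by auto
  moreover have "(\<Union>(v, gx, gy, w)\<in>set (answers r). {(gx, 0), (0, gy)} \<union> set_option w) \<subseteq> reach l k'"
    using new_round by (intro UN_least) (simp only: split_paired_all prod.case)
  moreover have "(\<Union>(v, gx, gy)\<in>set fs. {(gx, 0), (0, gy)}) \<subseteq> reach l k'"
    using new_full by (intro UN_least) (simp only: split_paired_all prod.case)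
  ultimately have gens: "span_generators h' \<subseteq> reach l k'"
    using old by simp
  have "choice A (feasible.truncate P) h' \<in> span (span_generators h')"
    using A by (simp add: pifo_algorithm_def)
  also have "\<dots> \<subseteq> reach l k'"
    using gens by (intro span_minimal subspace_reach)
  finally have new: "(proj X x, proj Y y) \<in> (Rn dx \<times> Y) \<inter> reach l k'"
    unfolding xy by (rule proj_mem_reach)
  have "span_generators (step n A P h s) = insert (proj X x, proj Y y) (span_generators h')"
    unfolding step span_generators_def by auto
  then show ?thesis
    using new gens h le unfolding confined_def k'_def[symmetric] by (auto simp: step h'_def)
qed

lemma iterate_mem_reach:
  assumes "pifo_algorithm c0 n A"
  shows "iterate n A P \<omega> \<in> (Rn dx \<times> Y) \<inter> reach l (length (filter lucky \<omega>))"
proof -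
  have "confined (k + length (filter lucky \<omega>)) (foldl (step n A P) h \<omega>)" if "confined k h" for k h
    using that
  proof (induction \<omega> arbitrary: k h)
    case (Cons s \<omega>)
    from Cons.IH[OF confined_step[OF assms Cons.prems, of s]] show ?case
      by (cases "lucky s") simp_all
  qed simp
  from this[OF confined_start] show ?thesis
    using last_in_set by (fastforce simp: confined_def iterate_def)
qed

end

section \<open>Counting lucky rounds\<close>

lemma finite_set_replicate_pmf:
  assumes "finite (set_pmf D)"
  shows "finite (set_pmf (replicate_pmf t D))"
proof -
  have "set_pmf (replicate_pmf t D) = {xs. set xs \<subseteq> set_pmf D \<and> length xs = t}"
    by (auto simp: set_replicate_pmf in_lists_conv_set)
  then show ?thesis
    using finite_lists_length_eq[OF assms] by simp
qed

lemma expectation_count_replicate_pmf: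
  assumes D: "finite (set_pmf D)"
  shows "measure_pmf.expectation (replicate_pmf t D) (\<lambda>\<omega>. real (length (filter Q \<omega>))) =
    real t * measure_pmf.prob D {s. Q s}"
proof (induction t)
  case (Suc t)
  let ?R = "replicate_pmf t D"
  have finp: "finite (set_pmf (pair_pmf D ?R))"
    using D finite_set_replicate_pmf[OF D] by simp
  have R: "replicate_pmf (Suc t) D = map_pmf (\<lambda>(x, xs). x # xs) (pair_pmf D ?R)"
    by (simp add: pair_pmf_def map_bind_pmf bind_map_pmf map_pmf_def bind_assoc_pmf bind_return_pmf)
  have "measure_pmf.expectation (replicate_pmf (Suc t) D) (\<lambda>\<omega>. real (length (filter Q \<omega>))) =
      measure_pmf.expectation (pair_pmf D ?R) (\<lambda>z. indicator {s. Q s} (fst z) + real (length (filter Q (snd z))))"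
    unfolding R by (auto simp: case_prod_beta indicator_def intro!: Bochner_Integration.integral_cong)
  also have "\<dots> = measure_pmf.expectation (pair_pmf D ?R) (\<lambda>z. indicator {s. Q s} (fst z)) +
      measure_pmf.expectation (pair_pmf D ?R) (\<lambda>z. real (length (filter Q (snd z))))"
    by (intro Bochner_Integration.integral_add integrable_measure_pmf_finite finp)
  also have "measure_pmf.expectation (pair_pmf D ?R) (\<lambda>z. indicator {s. Q s} (fst z)) =
      measure_pmf.expectation (map_pmf fst (pair_pmf D ?R)) (indicator {s. Q s} :: _ \<Rightarrow> real)"
    by (simp only: integral_map_pmf)
  also have "\<dots> = measure_pmf.prob D {s. Q s}"
    unfolding map_fst_pair_pmf by simp
  also have "measure_pmf.expectation (pair_pmf D ?R) (\<lambda>z. real (length (filter Q (snd z)))) =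
      measure_pmf.expectation (map_pmf snd (pair_pmf D ?R)) (\<lambda>\<omega>. real (length (filter Q \<omega>)))"
    by (simp only: integral_map_pmf)
  also have "\<dots> = real t * measure_pmf.prob D {s. Q s}"
    unfolding map_snd_pair_pmf by (rule Suc.IH)
  finally show ?case
    by (simp add: algebra_simps)
qed simp

lemma exists_le_average:
  fixes f :: "'a \<Rightarrow> real"
  assumes "finite S" "S \<noteq> {}" "sum f S \<le> 1"
  shows "\<exists>i\<in>S. f i \<le> 1 / real (card S)"
proof (rule ccontr)
  assume "\<not> ?thesis"
  then have "(\<Sum>i\<in>S. 1 / real (card S)) < sum f S"
    using assms by (intro sum_strict_mono) auto
  then show False
    using assms by simp
qed

text \<open>
  The least likely index has probability at most \<open>1 / n\<close>, and the least likely one among the others at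
  most \<open>1 / (n - 1) \<le> 2 / n\<close>.
\<close>
lemma two_unlikely_indices:
  assumes "set_pmf D \<subseteq> {1..n}" "2 \<le> n"
  obtains i j where "i \<in> {1..n}" "j \<in> {1..n}" "i \<noteq> j" "pmf D i + pmf D j \<le> 3 / real n"
proof -
  have sum: "sum (pmf D) {1..n} = 1"
    using assms by (intro sum_pmf_eq_1) auto
  then obtain i where i: "i \<in> {1..n}" "pmf D i \<le> 1 / real n"
    using exists_le_average[of "{1..n}" "pmf D"] assms by auto
  have "sum (pmf D) ({1..n} - {i}) \<le> 1"
    unfolding sum[symmetric] by (intro sum_mono2) auto
  moreover have card: "card ({1..n} - {i}) = n - 1"
    using i by simp
  moreover have "{1..n} - {i} \<noteq> {}"
    using card assms by (metis card.empty One_nat_def Suc_1 Suc_diff_le diff_is_0_eq not_less_eq_eq)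
  ultimately have "\<exists>j\<in>{1..n} - {i}. pmf D j \<le> 1 / real (card ({1..n} - {i}))"
    by (intro exists_le_average) auto
  then obtain j where j: "j \<in> {1..n} - {i}" "pmf D j \<le> 1 / real (n - 1)"
    unfolding card by blast
  have "1 / real (n - 1) \<le> 2 / real n"
    using assms by (simp add: field_simps of_nat_diff)
  then have "pmf D i + pmf D j \<le> 3 / real n"
    using i j by (simp add: add_divide_distrib[symmetric])
  then show ?thesis
    using that i j by auto
qed

context hidden_chain
begin

lemma prob_lucky_le:
  assumes "0 \<le> q" "q \<le> 1"
  shows "measure_pmf.prob (pair_pmf D (bernoulli_pmf q)) {s. lucky s} \<le> pmf D ia + pmf D ib + q"
proof -
  let ?M = "pair_pmf D (bernoulli_pmf q)"
  have "measure_pmf.prob ?M {s. lucky s} = measure_pmf.prob ?M (fst -` {ia, ib} \<union> snd -` {True})"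
    by (intro arg_cong[of _ _ "measure_pmf.prob ?M"]) (auto simp: lucky_def)
  also have "\<dots> \<le> measure_pmf.prob ?M (fst -` {ia, ib}) + measure_pmf.prob ?M (snd -` {True})"
    by (intro measure_Un_le) auto
  also have "measure_pmf.prob ?M (fst -` {ia, ib}) = measure_pmf.prob (map_pmf fst ?M) {ia, ib}"
    by simp
  also have "\<dots> = pmf D ia + pmf D ib"
    unfolding map_fst_pair_pmf using ia_neq_ib by (simp add: measure_measure_pmf_finite)
  also have "measure_pmf.prob ?M (snd -` {True}) = measure_pmf.prob (map_pmf snd ?M) {True}"
    by simp
  also have "\<dots> = q"
    unfolding map_snd_pair_pmf using assms by (simp add: measure_pmf_single)
  finally show ?thesis
    by simp
qed

text \<open>
  Markov's inequality in the form \<open>[N < p] \<ge> 1 - N / p\<close>, where N counts the lucky rounds: the gap is at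
  least G while \<open>N < p\<close>, and nonnegative afterwards.
\<close>
lemma expected_gap_ge:
  assumes A: "pifo_algorithm c0 n A" and p: "0 < p" and G: "0 \<le> G"
    and prob: "pmf (index_dist A) ia + pmf (index_dist A) ib + full_prob A \<le> \<rho>"
    and nonneg: "\<And>x y. x \<in> Rn dx \<Longrightarrow> y \<in> Y \<Longrightarrow> 0 \<le> primal_value n P x - dual_value n P y"
    and locked: "\<And>x y. x \<in> Rn dx \<Longrightarrow> y \<in> Y \<Longrightarrow> node l (x, y) p = 0 \<Longrightarrow>
      G \<le> primal_value n P x - dual_value n P y"
  shows "G * (1 - real t * \<rho> / real p) \<le> expected_gap n A P t"
proof -
  define D where "D = pair_pmf (index_dist A) (bernoulli_pmf (full_prob A))"
  have S: "samples A t = replicate_pmf t D"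
    by (simp add: samples_def D_def)
  have D: "finite (set_pmf D)"
    using A finite_subset[OF subset_UNIV, of "set_pmf (bernoulli_pmf (full_prob A))"]
    by (auto simp: D_def pifo_algorithm_def intro!: finite_cartesian_product elim: finite_subset)
  then have fin: "finite (set_pmf (samples A t))"
    unfolding S by (rule finite_set_replicate_pmf)
  let ?E = "measure_pmf.expectation (samples A t)"
  let ?N = "\<lambda>\<omega>. real (length (filter lucky \<omega>))"
  let ?gap = "\<lambda>\<omega>. primal_value n P (fst (iterate n A P \<omega>)) - dual_value n P (snd (iterate n A P \<omega>))"
  have "?E ?N = real t * measure_pmf.prob D {s. lucky s}"
    unfolding S by (rule expectation_count_replicate_pmf[OF D])
  also have "\<dots> \<le> real t * \<rho>"
    using prob prob_lucky_le[of "full_prob A" "index_dist A"] A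
    by (intro mult_left_mono) (auto simp: D_def pifo_algorithm_def)
  finally have N: "?E ?N \<le> real t * \<rho>" .
  have "G * (1 - real t * \<rho> / real p) \<le> G * (1 - ?E ?N / real p)"
    using N G p by (intro mult_left_mono diff_left_mono divide_right_mono) auto
  also have "\<dots> = ?E (\<lambda>\<omega>. G * (1 - ?N \<omega> / real p))"
    by (simp add: integrable_measure_pmf_finite[OF fin])
  also have "\<dots> \<le> ?E ?gap"
  proof (intro integral_mono integrable_measure_pmf_finite[OF fin])
    fix \<omega>
    have it: "iterate n A P \<omega> \<in> (Rn dx \<times> Y) \<inter> reach l (length (filter lucky \<omega>))"
      by (rule iterate_mem_reach[OF A])
    show "G * (1 - ?N \<omega> / real p) \<le> ?gap \<omega>"
    proof (cases "length (filter lucky \<omega>) < p")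
      case True
      then have "G \<le> ?gap \<omega>"
        using it by (intro locked) (auto simp: reach_def)
      moreover have "G * (1 - ?N \<omega> / real p) \<le> G * 1"
        using G by (intro mult_left_mono) auto
      ultimately show ?thesis
        by simp
    next
      case False
      then have "G * (1 - ?N \<omega> / real p) \<le> 0"
        using G p by (intro mult_nonneg_nonpos) (auto simp: le_divide_eq)
      also have "0 \<le> ?gap \<omega>"
        using it by (intro nonneg) auto
      finally show ?thesis .
    qed
  qed
  also have "\<dots> = expected_gap n A P t"
    unfolding expected_gap_def
    by (intro Bochner_Integration.integral_diff integrable_measure_pmf_finite[OF fin])
  finally show ?thesis .
qed

end

section \<open>From a saddle point of the chain to a lower bound\<close>

lemma le_complexityI:
  assumes "\<And>T. 1 \<le> T \<Longrightarrow> expected_gap n A P (T - 1) < \<epsilon> \<Longrightarrow> r \<le> real T"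
  shows "enat (nat \<lceil>r\<rceil>) \<le> complexity n A P \<epsilon>"
  unfolding complexity_def using assms by (intro INF_greatest) auto

text \<open>
  As long as \<open>(T - 1) * (3 + c0) / n \<le> p / 2\<close>, the expected gap is at least half of the gap of a
  point with node p covered, that is at least \<open>\<mu>x / 4\<close> times the square of node p of the saddle point.
\<close>
lemma (in hidden_chain) complexity_ge:
  assumes A: "pifo_algorithm c0 n A" and p: "0 < p" and "0 < c0"
    and prob: "pmf (index_dist A) ia + pmf (index_dist A) ib \<le> 3 / real n"
    and convex: "\<And>h. h \<in> Rn dx \<Longrightarrow> \<mu>x / 2 * (norm h)\<^sup>2 \<le> chain_quad p d c 0 (node l (h, 0))"
    and concave: "\<And>y y'. y \<in> Y \<Longrightarrow> y' \<in> Y \<Longrightarrow> chain_quad p d c 0 (node l (0, y - y')) \<le> - (\<mu>y / 2) * (norm (y - y'))\<^sup>2"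
    and saddle: "xs \<in> X" "ys \<in> Y" "\<And>\<upsilon>. chain_slope p d c b (node l (xs, ys)) \<upsilon> = 0"
    and \<mu>: "0 < \<mu>x" "0 < \<mu>y"
    and \<epsilon>: "\<epsilon> \<le> \<mu>x / 4 * (node l (xs, 0) p)\<^sup>2"
  shows "enat (nat \<lceil>real p * real n / (2 * (3 + c0))\<rceil>) \<le> complexity n A P \<epsilon>"
proof (rule le_complexityI)
  fix T assume T: "1 \<le> T" "expected_gap n A P (T - 1) < \<epsilon>"
  let ?gap = "\<lambda>x y. primal_value n P x - dual_value n P y"
  define G where "G = \<mu>x / 2 * (node l (xs, 0) p)\<^sup>2"
  have G: "0 \<le> G"
    using \<mu> by (simp add: G_def)
  have gap: "\<mu>x / 2 * (norm (x - xs))\<^sup>2 \<le> ?gap x y" if "x \<in> Rn dx" "y \<in> Y" for x y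
  proof -
    have "x - xs \<in> Rn dx"
      using that(1) subsetD[OF coord_box_subset_Rn saddle(1)[unfolded X_def]]
      by (intro subspace_diff subspace_Rn)
    then have "\<mu>x / 2 * (norm (x - xs))\<^sup>2 \<le> chain_quad p d c 0 (node l (x - xs, 0))"
      by (rule convex)
    moreover have "chain_quad p d c 0 (node l (0, y - ys)) \<le> - (\<mu>y / 2) * (norm (y - ys))\<^sup>2"
      by (rule concave[OF that(2) saddle(2)])
    moreover have "\<dots> \<le> 0"
      using \<mu> by simp
    ultimately show ?thesis
      using gap_ge_quadratic[OF saddle, of x y] by linarith
  qed
  have locked: "G \<le> ?gap x y" if "x \<in> Rn dx" "y \<in> Y" "node l (x, y) p = 0" for x y
  proof -
    have "node l (x, 0) p = 0"
      using node_split[of l x p y] that(3) by auto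
    then have "node l (x - xs, 0) p = - node l (xs, 0) p"
      using node_linear(5)[of l "(x, 0)" "(xs, 0)" p] by simp
    then have "\<bar>node l (xs, 0) p\<bar> \<le> norm (x - xs)"
      using abs_node_le_norm[of l "(x - xs, 0)" p] by (simp add: norm_Pair)
    then have "(node l (xs, 0) p)\<^sup>2 \<le> (norm (x - xs))\<^sup>2"
      using power_mono[of "\<bar>node l (xs, 0) p\<bar>" "norm (x - xs)" 2] by simp
    then have "G \<le> \<mu>x / 2 * (norm (x - xs))\<^sup>2"
      unfolding G_def using \<mu> by (intro mult_left_mono) auto
    then show ?thesis
      using gap[OF that(1,2)] by linarith
  qed
  have nonneg: "0 \<le> ?gap x y" if "x \<in> Rn dx" "y \<in> Y" for x y
    using gap[OF that] \<mu> by (smt (verit) mult_nonneg_nonneg zero_le_power2 half_gt_zero)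
  have prob': "pmf (index_dist A) ia + pmf (index_dist A) ib + full_prob A \<le> (3 + c0) / real n"
    using prob A by (auto simp: pifo_algorithm_def add_divide_distrib)
  define w where "w = real (T - 1) * ((3 + c0) / real n) / real p"
  have "G * (1 - w) \<le> expected_gap n A P (T - 1)"
    unfolding w_def using nonneg locked by (rule expected_gap_ge[OF A p G prob'])
  also have "\<dots> < \<epsilon>"
    by (rule T(2))
  also have "\<epsilon> \<le> G * (1 / 2)"
    using \<epsilon> by (simp add: G_def)
  finally have "1 - w < 1 / 2"
    using G by (simp only: mult_less_cancel_left_disj) auto
  then have "1 / 2 < real (T - 1) * ((3 + c0) / real n) / real p"
    unfolding w_def by linarith
  then have "real p * real n / (2 * (3 + c0)) < real (T - 1)"
    using p n_pos(1) \<open>0 < c0\<close> by (simp add: field_simps del: of_nat_diff of_nat_diff_real)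
  then show "real p * real n / (2 * (3 + c0)) \<le> real T"
    by simp
qed

text \<open>
  The complexity lets the problem depend on the algorithm. This is used only in the choice of ia and ib.
\<close>
theorem m_CC_ge_chain:
  assumes "0 < c0" "4 \<le> n" "0 < p" "0 < dx" "0 < dy"
    and nodes: "\<And>k. k \<le> p \<Longrightarrow> node_vec l k \<in> Rn dx \<times> Rn dy"
    and rx: "\<And>i. 0 \<le> rx i" and ry: "\<And>i. 0 \<le> ry i"
    and R: "0 \<le> Rx" "0 \<le> Ry" "(\<Sum>i<dx. (rx i)\<^sup>2) \<le> Rx\<^sup>2" "(\<Sum>i<dy. (ry i)\<^sup>2) \<le> Ry\<^sup>2"
    and d: "\<And>k. k \<le> p \<Longrightarrow> \<bar>d k\<bar> \<le> 3 / 5 * L" and c: "\<And>k. k < p \<Longrightarrow> \<bar>c k\<bar> \<le> L / (10 * sqrt (real n))"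
    and convex: "\<And>h. h \<in> Rn dx \<Longrightarrow> \<mu>x / 2 * (norm h)\<^sup>2 \<le> chain_quad p d c 0 (node l (h, 0))"
    and concave: "\<And>y y'. y \<in> coord_box dy (\<lambda>_. 0) ry \<Longrightarrow> y' \<in> coord_box dy (\<lambda>_. 0) ry \<Longrightarrow>
      chain_quad p d c 0 (node l (0, y - y')) \<le> - (\<mu>y / 2) * (norm (y - y'))\<^sup>2"
    and saddle: "xs \<in> coord_box dx (\<lambda>i. if i = 0 then \<xi> else 0) rx" "ys \<in> coord_box dy (\<lambda>_. 0) ry"
      "\<And>\<upsilon>. chain_slope p d c b (node l (xs, ys)) \<upsilon> = 0"
    and \<mu>: "0 < \<mu>x" "0 < \<mu>y"
    and \<epsilon>: "\<epsilon> \<le> \<mu>x / 4 * (node l (xs, 0) p)\<^sup>2"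
  shows "ereal (real p * real n / (2 * (3 + c0))) \<le> ereal_of_enat (m_CC c0 n \<epsilon> Rx Ry L \<mu>x \<mu>y)"
proof -
  let ?r = "real p * real n / (2 * (3 + c0))"
  have "enat (nat \<lceil>?r\<rceil>) \<le> (SUP P\<in>F_CC n Rx Ry L \<mu>x \<mu>y. complexity n A P \<epsilon>)" if A: "pifo_algorithm c0 n A" for A
  proof -
    obtain ia ib where i: "ia \<in> {1..n}" "ib \<in> {1..n}" "ia \<noteq> ib"
      "pmf (index_dist A) ia + pmf (index_dist A) ib \<le> 3 / real n"
    proof (rule two_unlikely_indices)
      show "set_pmf (index_dist A) \<subseteq> {1..n}" "2 \<le> n"
        using A assms(2) by (auto simp: pifo_algorithm_def)
    qed
    interpret H: hidden_chain l n p dx dy d c b ia ib \<xi> rx ry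
      using i assms(2) nodes rx ry by unfold_locales auto
    note XY = H.X_def[unfolded H.center_def] H.Y_def
    have diff: "x - x' \<in> Rn dx" if "x \<in> H.X" "x' \<in> H.X" for x x'
      using that unfolding H.X_def
      by (intro subspace_diff subspace_Rn coord_box_subset_Rn[THEN subsetD])
    have "H.P \<in> F_CC n Rx Ry L \<mu>x \<mu>y"
      using assms convex[OF diff] concave[folded XY] by (intro H.P_in_F_CC) auto
    moreover have "enat (nat \<lceil>?r\<rceil>) \<le> complexity n A H.P \<epsilon>"
      using A assms(3,1) i(4) convex concave[folded XY] saddle[folded XY] \<mu> \<epsilon> by (rule H.complexity_ge)
    ultimately show ?thesis
      by (rule SUP_upper2)
  qed
  then have "enat (nat \<lceil>?r\<rceil>) \<le> m_CC c0 n \<epsilon> Rx Ry L \<mu>x \<mu>y"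
    unfolding m_CC_def by (intro INF_greatest) simp
  then have "ereal_of_enat (enat (nat \<lceil>?r\<rceil>)) \<le> ereal_of_enat (m_CC c0 n \<epsilon> Rx Ry L \<mu>x \<mu>y)"
    by (simp only: ereal_of_enat_le_iff)
  moreover have "ereal ?r \<le> ereal_of_enat (enat (nat \<lceil>?r\<rceil>))"
    by (simp del: of_nat_mult add: real_nat_ceiling_ge)
  ultimately show ?thesis
    by (rule order_trans[rotated])
qed

section \<open>The straight chain\<close>

lemma sum_atMost_ends:
  fixes g :: "nat \<Rightarrow> real"
  shows "(\<Sum>k<p. g k) = sum g {..p} - g p" "(\<Sum>k<p. g (Suc k)) = sum g {..p} - g 0"
  using sum.atMost_shift[of g p] by (simp_all add: lessThan_Suc_atMost[symmetric])

text \<open>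
  The form is \<open>\<mu> / 2\<close> times the squared norm, plus the path Laplacian \<open>w / 2 * (\<Sum>k<p. (\<zeta> k - \<zeta> (Suc k))\<^sup>2)\<close>, plus
  nonnegative boundary terms.
\<close>
lemma straight_chain_convex:
  assumes "0 \<le> w" and d: "\<And>k. k < p \<Longrightarrow> d k = \<mu> + 2 * w" "\<mu> + w \<le> d p"
  shows "\<mu> / 2 * (\<Sum>k\<le>p. (\<zeta> k)\<^sup>2) \<le> chain_quad p d (\<lambda>_. - w) 0 \<zeta>"
proof -
  have "\<mu> / 2 * (\<Sum>k\<le>p. (\<zeta> k)\<^sup>2) + w / 2 * ((\<Sum>k<p. (\<zeta> k)\<^sup>2) + (\<Sum>k<p. (\<zeta> (Suc k))\<^sup>2))
      \<le> (\<Sum>k\<le>p. d k / 2 * (\<zeta> k)\<^sup>2)"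
  proof -
    have "(\<Sum>k\<le>p. d k / 2 * (\<zeta> k)\<^sup>2) = (\<Sum>k<p. (\<mu> + 2 * w) / 2 * (\<zeta> k)\<^sup>2) + d p / 2 * (\<zeta> p)\<^sup>2"
      using d(1) by (simp add: lessThan_Suc_atMost[symmetric])
    also have "\<dots> \<ge> (\<mu> + 2 * w) / 2 * (\<Sum>k<p. (\<zeta> k)\<^sup>2) + (\<mu> + w) / 2 * (\<zeta> p)\<^sup>2"
      using d(2) by (simp add: sum_distrib_left mult_right_mono)
    moreover have "0 \<le> w / 2 * (\<zeta> 0)\<^sup>2"
      using assms by simp
    ultimately show ?thesis
      unfolding sum_atMost_ends(2)[of "\<lambda>k. (\<zeta> k)\<^sup>2"] unfolding sum_atMost_ends(1)[of "\<lambda>k. (\<zeta> k)\<^sup>2"]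
      by (simp add: algebra_simps add_divide_distrib)
  qed
  moreover have "w * (\<Sum>k<p. \<zeta> k * \<zeta> (Suc k)) \<le> w * (\<Sum>k<p. ((\<zeta> k)\<^sup>2 + (\<zeta> (Suc k))\<^sup>2) / 2)"
  proof (intro mult_left_mono sum_mono)
    show "\<zeta> k * \<zeta> (Suc k) \<le> ((\<zeta> k)\<^sup>2 + (\<zeta> (Suc k))\<^sup>2) / 2" for k
      using sum_squares_bound[of "\<zeta> k" "\<zeta> (Suc k)"] by simp
  qed (use assms in auto)
  ultimately show ?thesis
    unfolding chain_quad_def by (simp add: sum_distrib_left[symmetric] sum_negf sum.distrib sum_divide_distrib[symmetric])
qed

lemma link_bound_le:
  fixes L :: real
  assumes "4 \<le> n" "0 \<le> L"
  shows "L / (10 * sqrt (real n)) \<le> L / 20"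
proof -
  have "sqrt (real n) \<ge> sqrt 4"
    using assms by (intro real_sqrt_le_mono) auto
  then have "2 \<le> sqrt (real n)"
    by simp
  moreover have "0 < 10 * sqrt (real n) * 20"
    using assms by simp
  ultimately show ?thesis
    using assms by (intro divide_left_mono) linarith+
qed

text \<open>
  The last diagonal entry is chosen such that the geometric sequence \<open>a * \<theta> ^ k\<close>, which solves the
  recurrence of the infinite chain, also satisfies the condition at the end of the finite one.
\<close>
lemma m_CC_ge_straight_chain:
  assumes "0 < c0" "4 \<le> n" "0 < p" and \<mu>: "0 < \<mu>x" "0 < \<mu>y" "2 * \<mu>x \<le> L" and R: "0 \<le> Rx" "0 \<le> Ry"
    and w: "0 < w" "w \<le> L / (10 * sqrt (real n))"
    and \<theta>: "0 < \<theta>" "\<theta> < 1" "\<mu>x = w * (\<theta> + 1 / \<theta> - 2)"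
    and rx: "\<And>i. 0 \<le> rx i" "\<And>i. i \<le> p \<Longrightarrow> \<bar>a * \<theta> ^ i - (if i = 0 then \<xi> else 0)\<bar> \<le> rx i"
      "(\<Sum>i<Suc p. (rx i)\<^sup>2) \<le> Rx\<^sup>2"
    and \<epsilon>: "\<epsilon> \<le> \<mu>x / 4 * (a * \<theta> ^ p)\<^sup>2"
  shows "ereal (real p * real n / (2 * (3 + c0))) \<le> ereal_of_enat (m_CC c0 n \<epsilon> Rx Ry L \<mu>x \<mu>y)"
proof -
  define d where "d k = (if k < p then w * (\<theta> + 1 / \<theta>) else w / \<theta>)" for k
  define xs where "xs = vec_of (Suc p) (\<lambda>i. a * \<theta> ^ i)"
  have d0: "d k = \<mu>x + 2 * w" if "k < p" for k
    using that \<theta>(3) by (simp add: d_def algebra_simps)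
  have dp: "d p = \<mu>x + 2 * w - w * \<theta>"
    using \<theta>(3) by (simp add: d_def algebra_simps)
  have w\<theta>: "0 < w * \<theta>" "w * \<theta> < w"
    using w \<theta> by auto
  have node_y: "node Primal (0, h) = (\<lambda>_. 0)" for h
    by (auto simp: node_Primal)
  have wL: "w \<le> L / 20"
    using w link_bound_le[of n L] assms(2) \<mu> by simp
  show ?thesis
  proof (rule m_CC_ge_chain[where dx = "Suc p" and dy = 1 and l = Primal and d = d and c = "\<lambda>_. - w"
        and b = "w * a / \<theta>" and rx = rx and ry = "\<lambda>_. 0" and \<xi> = \<xi> and xs = xs and ys = 0])
    show "node_vec Primal k \<in> Rn (Suc p) \<times> Rn 1" if "k \<le> p" for k
      using that by (auto simp: Rn_def)
    show "\<bar>d k\<bar> \<le> 3 / 5 * L" if "k \<le> p" for k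
    proof (cases "k = p")
      case True
      show ?thesis
        unfolding True dp using \<mu> w\<theta> w wL by linarith
    next
      case False
      then show ?thesis
        using that d0[of k] \<mu> w wL by simp
    qed
    show "\<bar>- w\<bar> \<le> L / (10 * sqrt (real n))"
      using w by simp
    show "\<mu>x / 2 * (norm h)\<^sup>2 \<le> chain_quad p d (\<lambda>_. - w) 0 (node Primal (h, 0))" if "h \<in> Rn (Suc p)" for h
      using straight_chain_convex[of w p d \<mu>x "node Primal (h, 0)"] d0 dp w\<theta> w
      by (simp add: norm_Rn[OF that] node_Primal lessThan_Suc_atMost)
    show "chain_quad p d (\<lambda>_. - w) 0 (node Primal (0, y - y')) \<le> - (\<mu>y / 2) * (norm (y - y'))\<^sup>2"
      if "y \<in> coord_box 1 (\<lambda>_. 0) (\<lambda>_. 0)" "y' \<in> coord_box 1 (\<lambda>_. 0) (\<lambda>_. 0)" for y y'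
      using dist_box_le[OF that, of 0] unfolding node_y by (simp add: dist_norm chain_quad_def)
    show "xs \<in> coord_box (Suc p) (\<lambda>i. if i = 0 then \<xi> else 0) rx"
      unfolding xs_def using rx by (intro vec_of_mem_box) auto
    show "0 \<in> coord_box 1 (\<lambda>_. 0) (\<lambda>_. 0)"
      by (auto simp: coord_box_def Rn_def)
    have xs: "node Primal (xs, 0) k = a * \<theta> ^ k" if "k \<le> p" for k
      using that by (simp add: node_Primal xs_def)
    show "chain_slope p d (\<lambda>_. - w) (w * a / \<theta>) (node Primal (xs, 0)) \<upsilon> = 0" for \<upsilon>
    proof (rule chain_slope_eq_0)
      show "d 0 * node Primal (xs, 0) 0 + - w * node Primal (xs, 0) 1 = w * a / \<theta>"
        using assms(3) xs[of 0] xs[of 1] \<theta> by (simp add: d_def field_simps)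
      show "- w * node Primal (xs, 0) k + d (Suc k) * node Primal (xs, 0) (Suc k)
          + - w * node Primal (xs, 0) (Suc (Suc k)) = 0" if "Suc k < p" for k
        using that xs[of k] xs[of "Suc k"] xs[of "Suc (Suc k)"] \<theta>(1,2) by (simp add: d_def field_simps)
      obtain m where "p = Suc m"
        using assms(3) gr0_implies_Suc by blast
      then show "- w * node Primal (xs, 0) (p - 1) + d p * node Primal (xs, 0) p = 0"
        using xs[of m] xs[of p] \<theta> by (simp add: d_def field_simps)
    qed (rule assms(3))
    show "\<epsilon> \<le> \<mu>x / 4 * (node Primal (xs, 0) p)\<^sup>2"
      using \<epsilon> xs[of p] by simp
  qed (use assms in auto)
qed

section \<open>The alternating chain\<close>

lemma sum_alternating:
  fixes g :: "nat \<Rightarrow> real"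
  shows "(\<Sum>k\<le>2 * m. if even k then g (k div 2) else 0) = (\<Sum>i<Suc m. g i)"
    and "(\<Sum>k\<le>2 * m. if even k then 0 else g (k div 2)) = (\<Sum>i<m. g i)"
  by (induction m) auto

lemma norm_alternating:
  shows "h \<in> Rn (Suc m) \<Longrightarrow> (norm h)\<^sup>2 = (\<Sum>k\<le>2 * m. (node Alternating (h, 0) k)\<^sup>2)"
    and "h \<in> Rn m \<Longrightarrow> (norm h)\<^sup>2 = (\<Sum>k\<le>2 * m. (node Alternating (0, h) k)\<^sup>2)"
proof -
  show "(norm h)\<^sup>2 = (\<Sum>k\<le>2 * m. (node Alternating (h, 0) k)\<^sup>2)" if "h \<in> Rn (Suc m)"
    unfolding norm_Rn[OF that] sum_alternating(1)[symmetric] by (intro sum.cong) (auto simp: node_Alternating)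
  show "(norm h)\<^sup>2 = (\<Sum>k\<le>2 * m. (node Alternating (0, h) k)\<^sup>2)" if "h \<in> Rn m"
    unfolding norm_Rn[OF that] sum_alternating(2)[symmetric] by (intro sum.cong) (auto simp: node_Alternating)
qed

lemma sum_powers_le:
  fixes \<theta> :: real
  assumes "0 < \<theta>" "\<theta> < 1"
  shows "(\<Sum>i<m. (\<theta> ^ i)\<^sup>2) \<le> 1 / (1 - \<theta>\<^sup>2)"
proof -
  have "\<theta>\<^sup>2 < 1"
    using assms by (simp add: power_less_one_iff)
  then show ?thesis
    using assms by (simp add: power2_eq_square power_mult_distrib[symmetric] sum_gp_strict divide_right_mono)
qed

text \<open>
  Primal and dual nodes decay at the common rate \<open>\<theta>\<close> when their amplitudes have the ratio
  \<open>\<rho> = sqrt (\<mu>x / \<mu>y)\<close>. The signs of the links alternate, so that the recurrence is solved by a sequence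
  without oscillation. The last diagonal entry is again adapted to the end of the chain; the chain
  ends with a primal node because there the adaptation \<open>w * \<theta> * \<rho>\<close> is small.
\<close>
lemma m_CC_ge_alternating_chain:
  assumes "0 < c0" "4 \<le> n" "0 < m" and \<mu>: "0 < \<mu>x" "\<mu>x \<le> \<mu>y" "2 * \<mu>y \<le> L" and R: "0 \<le> Rx" "0 \<le> Ry"
    and w: "0 < w" "w \<le> L / (10 * sqrt (real n))"
    and \<theta>: "0 < \<theta>" "\<theta> < 1" "w * (1 / \<theta> - \<theta>) = sqrt (\<mu>x * \<mu>y)"
    and a: "0 \<le> a" "a\<^sup>2 \<le> (1 - \<theta>\<^sup>2) * Rx\<^sup>2" "a\<^sup>2 \<le> (1 - \<theta>\<^sup>2) * Ry\<^sup>2"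
    and \<epsilon>: "\<epsilon> \<le> \<mu>x / 4 * (a * \<theta> ^ (2 * m))\<^sup>2"
  shows "ereal (real (2 * m) * real n / (2 * (3 + c0))) \<le> ereal_of_enat (m_CC c0 n \<epsilon> Rx Ry L \<mu>x \<mu>y)"
proof -
  define \<rho> where "\<rho> = sqrt (\<mu>x / \<mu>y)"
  define d where "d k = (if odd k then - \<mu>y else if k < 2 * m then \<mu>x else \<mu>x + w * \<theta> * \<rho>)" for k
  define c where "c k = (if even k then w else - w)" for k :: nat
  define z where "z k = (if even k then a * \<theta> ^ k else a * \<rho> * \<theta> ^ k)" for k
  define rx where "rx i = a * \<theta> ^ (2 * i)" for i
  define ry where "ry i = a * \<rho> * \<theta> ^ (2 * i + 1)" for i
  define xs where "xs = vec_of (Suc m) rx"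
  define ys where "ys = vec_of m ry"
  have \<mu>y: "0 < \<mu>y"
    using \<mu> by simp
  have \<rho>: "0 < \<rho>" "\<rho> \<le> 1"
    using \<mu> by (auto simp: \<rho>_def)
  have sx: "\<rho> * (w * (1 / \<theta> - \<theta>)) = \<mu>x" and sy: "\<rho> * \<mu>y = w * (1 / \<theta> - \<theta>)"
    unfolding \<theta>(3) \<rho>_def using \<mu> by (simp_all add: real_sqrt_divide real_sqrt_mult field_simps)
  have zn: "node Alternating (xs, ys) k = z k" if "k \<le> 2 * m" for k
    using that by (auto simp: node_Alternating xs_def ys_def rx_def ry_def z_def elim!: evenE oddE)
  have wL: "w \<le> L / 20"
    using w link_bound_le[of n L] assms(2) \<mu> by simp
  have \<delta>: "0 \<le> w * \<theta> * \<rho>" "w * \<theta> * \<rho> \<le> w"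
    using w \<theta> \<rho> mult_le_one[of \<theta> \<rho>] by (auto simp: mult.assoc mult_left_le)
  have geo: "(\<Sum>i<k. (a * (\<theta> ^ i)) ^ 2) \<le> R\<^sup>2" if "a\<^sup>2 \<le> (1 - \<theta>\<^sup>2) * R\<^sup>2" for k R
  proof -
    have \<theta>2: "0 < 1 - \<theta>\<^sup>2"
      using \<theta> by (simp add: power_less_one_iff)
    have "(\<Sum>i<k. (a * (\<theta> ^ i)) ^ 2) \<le> a\<^sup>2 * (1 / (1 - \<theta>\<^sup>2))"
      using sum_powers_le[OF \<theta>(1,2), of k] by (simp add: power_mult_distrib sum_distrib_left[symmetric] mult_left_mono del: times_divide_eq_right)
    also have "\<dots> \<le> R\<^sup>2"
      using that \<theta>2 by (simp add: divide_le_eq mult.commute)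
    finally show ?thesis .
  qed
  have sums: "(\<Sum>i<k. (rx i)\<^sup>2) \<le> (\<Sum>i<k. (a * (\<theta> ^ i)) ^ 2)" "(\<Sum>i<k. (ry i)\<^sup>2) \<le> (\<Sum>i<k. (a * (\<theta> ^ i)) ^ 2)" for k
  proof -
    have "\<theta> ^ (2 * i) \<le> \<theta> ^ i" "\<theta> ^ (2 * i + 1) \<le> \<theta> ^ i" for i
      using \<theta> by (intro power_decreasing; simp)+
    then show "(\<Sum>i<k. (rx i)\<^sup>2) \<le> (\<Sum>i<k. (a * (\<theta> ^ i)) ^ 2)" "(\<Sum>i<k. (ry i)\<^sup>2) \<le> (\<Sum>i<k. (a * (\<theta> ^ i)) ^ 2)"
      unfolding rx_def ry_def using a(1) \<theta> \<rho>
      by (auto intro!: sum_mono power_mono mult_mono mult_left_le simp del: power_Suc)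
  qed
  show ?thesis
  proof (rule m_CC_ge_chain[where dx = "Suc m" and dy = m and l = Alternating and d = d and c = c
        and b = "\<mu>x * a + w * a * \<rho> * \<theta>" and rx = rx and ry = ry and \<xi> = 0 and xs = xs and ys = ys])
    show "node_vec Alternating k \<in> Rn (Suc m) \<times> Rn m" if "k \<le> 2 * m" for k
      using that by (auto simp: Rn_def elim!: oddE)
    show "0 \<le> rx i" "0 \<le> ry i" for i
      using a \<rho> \<theta> by (auto simp: rx_def ry_def)
    show "(\<Sum>i<Suc m. (rx i)\<^sup>2) \<le> Rx\<^sup>2" "(\<Sum>i<m. (ry i)\<^sup>2) \<le> Ry\<^sup>2"
      using sums geo a(2,3) order_trans by meson+
    show "\<bar>d k\<bar> \<le> 3 / 5 * L" for k
    proof -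
      have "d k = - \<mu>y \<or> d k = \<mu>x \<or> d k = \<mu>x + w * \<theta> * \<rho>"
        by (simp add: d_def)
      then show ?thesis
        using \<mu> \<delta> wL w by linarith
    qed
    show "\<bar>c k\<bar> \<le> L / (10 * sqrt (real n))" for k
      using w by (simp add: c_def)
    show "\<mu>x / 2 * (norm h)\<^sup>2 \<le> chain_quad (2 * m) d c 0 (node Alternating (h, 0))" if "h \<in> Rn (Suc m)" for h
    proof -
      have "\<mu>x / 2 * (node Alternating (h, 0) k)\<^sup>2 \<le> d k / 2 * (node Alternating (h, 0) k)\<^sup>2" for k
        using \<delta> by (auto simp: d_def node_Alternating intro!: mult_right_mono)
      moreover have "(\<Sum>k<2 * m. c k * (node Alternating (h, 0) k * node Alternating (h, 0) (Suc k))) = 0"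
        by (intro sum.neutral) (auto simp: node_Alternating)
      ultimately show ?thesis
        unfolding norm_alternating(1)[OF that] chain_quad_def sum_distrib_left by (simp add: sum_mono del: times_divide_eq_left)
    qed
    show "chain_quad (2 * m) d c 0 (node Alternating (0, y - y')) \<le> - (\<mu>y / 2) * (norm (y - y'))\<^sup>2"
      if "y \<in> coord_box m (\<lambda>_. 0) ry" "y' \<in> coord_box m (\<lambda>_. 0) ry" for y y'
    proof -
      have h: "y - y' \<in> Rn m"
        using that coord_box_subset_Rn by (intro subspace_diff subspace_Rn) blast+
      have "d k / 2 * (node Alternating (0, y - y') k)\<^sup>2 = - (\<mu>y / 2) * (node Alternating (0, y - y') k)\<^sup>2" for k
        by (auto simp: d_def node_Alternating)
      moreover have "(\<Sum>k<2 * m. c k * (node Alternating (0, y - y') k * node Alternating (0, y - y') (Suc k))) = 0"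
        by (intro sum.neutral) (auto simp: node_Alternating)
      ultimately show ?thesis
        unfolding norm_alternating(2)[OF h] chain_quad_def by (simp add: sum_distrib_left sum_negf del: times_divide_eq_left)
    qed
    show "xs \<in> coord_box (Suc m) (\<lambda>i. if i = 0 then 0 else 0) rx"
      unfolding xs_def using \<open>\<And>i. 0 \<le> rx i\<close> by (intro vec_of_mem_box) auto
    show "ys \<in> coord_box m (\<lambda>_. 0) ry"
      unfolding ys_def using \<open>\<And>i. 0 \<le> ry i\<close> by (intro vec_of_mem_box) auto
    show "chain_slope (2 * m) d c (\<mu>x * a + w * a * \<rho> * \<theta>) (node Alternating (xs, ys)) \<upsilon> = 0" for \<upsilon>
    proof (rule chain_slope_eq_0)
      show "0 < 2 * m"
        using assms(3) by simp
      show "d 0 * node Alternating (xs, ys) 0 + c 0 * node Alternating (xs, ys) 1 = \<mu>x * a + w * a * \<rho> * \<theta>"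
        using assms(3) by (simp add: zn) (simp add: z_def d_def c_def)
      show "c k * node Alternating (xs, ys) k + d (Suc k) * node Alternating (xs, ys) (Suc k)
          + c (Suc k) * node Alternating (xs, ys) (Suc (Suc k)) = 0" if k: "Suc k < 2 * m" for k
      proof (cases "even k")
        case True
        have "c k * z k + d (Suc k) * z (Suc k) + c (Suc k) * z (Suc (Suc k)) =
            a * \<theta> ^ Suc k * (w * (1 / \<theta> - \<theta>) - \<rho> * \<mu>y)"
          using True \<theta>(1) by (simp add: z_def d_def c_def field_simps)
        then show ?thesis
          using k sy by (simp add: zn)
      next
        case False
        have "c k * z k + d (Suc k) * z (Suc k) + c (Suc k) * z (Suc (Suc k)) =
            a * \<theta> ^ Suc k * (\<mu>x - \<rho> * (w * (1 / \<theta> - \<theta>)))"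
          using False k \<theta>(1) by (simp add: z_def d_def c_def field_simps)
        then show ?thesis
          using k sx by (simp add: zn)
      qed
      obtain k where k: "m = Suc k"
        using assms(3) gr0_implies_Suc by blast
      have "c (2 * m - 1) * z (2 * m - 1) + d (2 * m) * z (2 * m) =
          a * \<theta> ^ (2 * m) * (\<mu>x - \<rho> * (w * (1 / \<theta> - \<theta>)))"
        using k \<theta>(1) by (simp add: z_def d_def c_def field_simps)
      then show "c (2 * m - 1) * node Alternating (xs, ys) (2 * m - 1) + d (2 * m) * node Alternating (xs, ys) (2 * m) = 0"
        using sx by (simp add: zn)
    qed
    have "node Alternating (xs, 0) (2 * m) = a * \<theta> ^ (2 * m)"
      by (simp add: node_Alternating xs_def rx_def)
    then show "\<epsilon> \<le> \<mu>x / 4 * (node Alternating (xs, 0) (2 * m))\<^sup>2"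
      using \<epsilon> by simp
  qed (use assms \<mu>y in auto)
qed

section \<open>Choosing the length of the chain\<close>

lemma obtain_decay_rate:
  fixes r :: real
  assumes "0 < r"
  obtains \<eta> where "0 < \<eta>" "\<eta> < 1" "1 / \<eta> - \<eta> = r" "ln (1 / \<eta>) \<le> r"
proof -
  \<comment> \<open>the positive root of \<open>\<eta>\<^sup>2 + r * \<eta> - 1\<close>\<close>
  define \<eta> where "\<eta> = (sqrt (r\<^sup>2 + 4) - r) / 2"
  have "r < sqrt (r\<^sup>2 + 4)"
    using assms by (intro real_less_rsqrt) simp
  moreover have "sqrt (r\<^sup>2 + 4) < r + 2"
    using assms by (intro real_less_lsqrt) (auto simp: power2_eq_square algebra_simps)
  ultimately have \<eta>: "0 < \<eta>" "\<eta> < 1"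
    by (auto simp: \<eta>_def)
  have "2 * \<eta> + r = sqrt (r\<^sup>2 + 4)"
    by (simp add: \<eta>_def diff_divide_distrib)
  then have "(2 * \<eta> + r)\<^sup>2 = r\<^sup>2 + 4"
    by simp
  then have "1 - \<eta> * \<eta> = r * \<eta>"
    by (simp add: power2_eq_square algebra_simps)
  then have eq: "1 / \<eta> - \<eta> = r"
    using \<eta> by (simp add: field_simps)
  have "ln (1 / \<eta>) \<le> 1 / \<eta> - 1"
    using \<eta> by (intro ln_le_minus_one) simp
  also have "\<dots> \<le> r"
    using eq \<eta> by simp
  finally show ?thesis
    using that \<eta> eq by blast
qed

lemma obtain_straight_decay_rate:
  fixes \<mu> w :: real
  assumes "0 < \<mu>" "0 < w"
  obtains \<theta> where "0 < \<theta>" "\<theta> < 1" "\<mu> = w * (\<theta> + 1 / \<theta> - 2)" "ln (1 / \<theta>) \<le> 2 * sqrt (\<mu> / w)"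
proof -
  obtain \<eta> where \<eta>: "0 < \<eta>" "\<eta> < 1" "1 / \<eta> - \<eta> = sqrt (\<mu> / w)" "ln (1 / \<eta>) \<le> sqrt (\<mu> / w)"
    using assms by (auto intro: obtain_decay_rate[of "sqrt (\<mu> / w)"])
  have "\<mu> = w * (1 / \<eta> - \<eta>)\<^sup>2"
    unfolding \<eta>(3) using assms by simp
  also have "(1 / \<eta> - \<eta>)\<^sup>2 = \<eta>\<^sup>2 + 1 / \<eta>\<^sup>2 - 2"
    using \<eta>(1) by (simp add: power2_eq_square field_simps)
  finally have "\<mu> = w * (\<eta>\<^sup>2 + 1 / \<eta>\<^sup>2 - 2)" .
  then show ?thesis
    using that[of "\<eta>\<^sup>2"] \<eta> by (simp add: power_less_one_iff ln_div ln_realpow)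
qed

text \<open>
  Since \<open>(\<theta> ^ p)\<^sup>2 = exp (- 2 * p * ln (1 / \<theta>))\<close>, the last node is visible at accuracy \<open>\<epsilon>\<close> for p up to
  \<open>ln (s' / \<epsilon>) / (2 * ln (1 / \<theta>))\<close>. Rounding down to an even number loses less than 2, which is a factor
  \<open>\<theta> ^ 4\<close> in the scale.
\<close>
lemma even_chain_length:
  fixes \<theta> s' \<epsilon> :: real
  assumes "0 < \<theta>" "\<theta> < 1" "0 < s'" "0 < \<epsilon>" "\<epsilon> < s' * \<theta> ^ 4"
  obtains m :: nat where "0 < m" "ln (s' * \<theta> ^ 4 / \<epsilon>) / (2 * ln (1 / \<theta>)) \<le> real (2 * m)"
    "\<epsilon> \<le> s' * (\<theta> ^ (2 * m))\<^sup>2"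
proof -
  define \<tau> where "\<tau> = ln (1 / \<theta>)"
  have \<tau>: "0 < \<tau>" "ln \<theta> = - \<tau>"
    using assms by (auto simp: \<tau>_def ln_div)
  have ln_s: "ln (s' * \<theta> ^ 4 / \<epsilon>) = ln (s' / \<epsilon>) - 4 * \<tau>"
    using assms by (simp add: ln_div ln_mult ln_realpow \<tau>)
  have "0 < ln (s' * \<theta> ^ 4 / \<epsilon>)"
    using assms by simp
  then have x: "1 < ln (s' / \<epsilon>) / (4 * \<tau>)"
    using \<tau> by (simp add: ln_s)
  define m where "m = nat \<lfloor>ln (s' / \<epsilon>) / (4 * \<tau>)\<rfloor>"
  have m: "real m \<le> ln (s' / \<epsilon>) / (4 * \<tau>)" "ln (s' / \<epsilon>) / (4 * \<tau>) < real m + 1"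
    using x by (auto simp: m_def)
  have "0 < m"
    using m x by linarith
  moreover have "ln (s' * \<theta> ^ 4 / \<epsilon>) / (2 * ln (1 / \<theta>)) \<le> real (2 * m)"
    using m(2) \<tau> unfolding ln_s \<tau>_def[symmetric] by (simp add: field_simps)
  moreover have "\<epsilon> \<le> s' * (\<theta> ^ (2 * m))\<^sup>2"
  proof -
    have "real m * (4 * \<tau>) \<le> ln (s' / \<epsilon>)"
      using m(1) \<tau> by (simp add: field_simps)
    then have "ln \<epsilon> \<le> ln s' + real (2 * m * 2) * ln \<theta>"
      using assms by (simp add: ln_div \<tau> algebra_simps)
    also have "\<dots> = ln (s' * (\<theta> ^ (2 * m))\<^sup>2)"
      unfolding power_mult[symmetric] using assms by (subst ln_mult) (auto simp: ln_realpow)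
    finally show ?thesis
      using assms by simp
  qed
  ultimately show ?thesis
    using that by blast
qed

text \<open>
  Here r is the cost per node and W the factor of the logarithm in the resulting bound. For \<open>\<epsilon>\<close> above
  the scale the logarithm is not positive and there is nothing to show.
\<close>
lemma scale_from_chain_length:
  fixes \<theta> s' C W r :: real
  assumes \<theta>: "0 < \<theta>" "\<theta> < 1" and "0 < s'" "0 < C" "0 \<le> W" "W * (2 * ln (1 / \<theta>)) \<le> r" "0 < r"
    and bound: "\<And>\<epsilon> m. 0 < \<epsilon> \<Longrightarrow> 0 < m \<Longrightarrow> \<epsilon> \<le> s' * (\<theta> ^ (2 * m))\<^sup>2 \<Longrightarrow>
      ereal (C * r * real (2 * m)) \<le> ereal_of_enat (M \<epsilon>)"
  shows "\<exists>s>0. \<forall>\<epsilon>>0. ereal (C * (W * ln (s / \<epsilon>))) \<le> ereal_of_enat (M \<epsilon>)"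
proof (intro exI[of _ "s' * \<theta> ^ 4"] conjI allI impI)
  show "0 < s' * \<theta> ^ 4"
    using assms by simp
next
  fix \<epsilon> :: real
  assume \<epsilon>: "0 < \<epsilon>"
  let ?ln = "ln (s' * \<theta> ^ 4 / \<epsilon>)"
  show "ereal (C * (W * ?ln)) \<le> ereal_of_enat (M \<epsilon>)"
  proof (cases "\<epsilon> < s' * \<theta> ^ 4")
    case True
    then obtain m where m: "0 < m" "?ln / (2 * ln (1 / \<theta>)) \<le> real (2 * m)" "\<epsilon> \<le> s' * (\<theta> ^ (2 * m))\<^sup>2"
      using even_chain_length[OF \<theta> assms(3) \<epsilon>] by blast
    have \<tau>: "0 < 2 * ln (1 / \<theta>)"
      using \<theta> by simp
    have "W * ?ln = W * (2 * ln (1 / \<theta>)) * (?ln / (2 * ln (1 / \<theta>)))"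
      using \<tau> by (simp add: field_simps)
    also have "\<dots> \<le> r * real (2 * m)"
      using m(2) assms \<tau> True \<epsilon> by (intro mult_mono divide_nonneg_pos) auto
    finally have "C * (W * ?ln) \<le> C * r * real (2 * m)"
      using assms(4) by (simp add: mult.assoc)
    then have "ereal (C * (W * ?ln)) \<le> ereal (C * r * real (2 * m))"
      by simp
    also have "\<dots> \<le> ereal_of_enat (M \<epsilon>)"
      using \<epsilon> m by (intro bound)
    finally show ?thesis .
  next
    case False
    then have "?ln \<le> 0"
      using \<epsilon> assms by (simp add: ln_le_zero_iff)
    then have "ereal (C * (W * ?ln)) \<le> 0"
      using assms by (simp add: mult_nonneg_nonpos)
    also have "0 \<le> ereal_of_enat (M \<epsilon>)"
      by simp
    finally show ?thesis .
  qed
qed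

section \<open>The three regimes\<close>

lemma lower_bound_both_ill_conditioned:
  assumes "0 < c0" "4 \<le> n" and \<mu>: "0 < \<mu>x" "\<mu>x \<le> \<mu>y" "2 * \<mu>y \<le> L" and R: "0 < Rx" "0 < Ry"
  shows "\<exists>s>0. \<forall>\<epsilon>>0. ereal (1 / (40 * (3 + c0)) * (sqrt (L / \<mu>x * (L / \<mu>y) * real n) * ln (s / \<epsilon>)))
    \<le> ereal_of_enat (m_CC c0 n \<epsilon> Rx Ry L \<mu>x \<mu>y)"
proof -
  define w where "w = L / (10 * sqrt (real n))"
  have w: "0 < w"
    using assms by (simp add: w_def)
  define r where "r = sqrt (\<mu>x * \<mu>y) / w"
  have r: "0 < r"
    using w \<mu> by (simp add: r_def)
  obtain \<theta> where \<theta>: "0 < \<theta>" "\<theta> < 1" "1 / \<theta> - \<theta> = r" "ln (1 / \<theta>) \<le> r"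
    by (rule obtain_decay_rate[OF r])
  \<comment> \<open>the largest amplitude for which the geometric sum of the squares stays below both radii\<close>
  define a where "a = min Rx Ry * sqrt (1 - \<theta>\<^sup>2)"
  have \<theta>2: "0 < 1 - \<theta>\<^sup>2"
    using \<theta> by (simp add: power_less_one_iff)
  have a: "0 < a"
    using R \<theta>2 by (simp add: a_def)
  have aR: "a\<^sup>2 \<le> (1 - \<theta>\<^sup>2) * R\<^sup>2" if "min Rx Ry \<le> R" for R
    using \<theta>2 that R power_mono[of "min Rx Ry" R 2] by (simp add: a_def power_mult_distrib mult.commute mult_left_mono)
  have W: "sqrt (L / \<mu>x * (L / \<mu>y) * real n) * (2 * ln (1 / \<theta>)) \<le> 20 * real n"
  proof -
    have "sqrt (L / \<mu>x * (L / \<mu>y) * real n) = L / sqrt (\<mu>x * \<mu>y) * sqrt (real n)"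
      using \<mu> by (simp add: real_sqrt_mult real_sqrt_divide)
    moreover have "2 * ln (1 / \<theta>) \<le> 2 * r"
      using \<theta> by simp
    ultimately have "sqrt (L / \<mu>x * (L / \<mu>y) * real n) * (2 * ln (1 / \<theta>)) \<le> L / sqrt (\<mu>x * \<mu>y) * sqrt (real n) * (2 * r)"
      using \<mu> by (simp only:) (intro mult_left_mono; simp)
    also have "\<dots> = 2 * L * sqrt (real n) / w"
      using \<mu> w by (simp add: r_def)
    also have "\<dots> = 20 * real n"
      using \<mu> assms(2) by (simp add: w_def)
    finally show ?thesis .
  qed
  have "ereal (1 / (40 * (3 + c0)) * (20 * real n) * real (2 * m)) \<le> ereal_of_enat (m_CC c0 n \<epsilon> Rx Ry L \<mu>x \<mu>y)"
    if "0 < m" and \<epsilon>: "\<epsilon> \<le> \<mu>x / 4 * a\<^sup>2 * (\<theta> ^ (2 * m))\<^sup>2" for \<epsilon> m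
  proof -
    have "ereal (real (2 * m) * real n / (2 * (3 + c0))) \<le> ereal_of_enat (m_CC c0 n \<epsilon> Rx Ry L \<mu>x \<mu>y)"
    proof (rule m_CC_ge_alternating_chain)
      show "w * (1 / \<theta> - \<theta>) = sqrt (\<mu>x * \<mu>y)"
        unfolding \<theta>(3) using w by (simp add: r_def)
      show "\<epsilon> \<le> \<mu>x / 4 * (a * \<theta> ^ (2 * m))\<^sup>2"
        using \<epsilon> by (simp add: power_mult_distrib mult.assoc)
    qed (use assms that a aR w \<theta> in \<open>auto simp: w_def\<close>)
    moreover have "real (2 * m) * real n / (2 * (3 + c0)) = 1 / (40 * (3 + c0)) * (20 * real n) * real (2 * m)"
      using assms(1) by (simp add: divide_simps)
    ultimately show ?thesis
      by (simp only:)
  qed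
  then show ?thesis
    using \<theta> a \<mu> assms W by (intro scale_from_chain_length[of \<theta> "\<mu>x / 4 * a\<^sup>2" _ _ "20 * real n"]) auto
qed

lemma powr_three_quarters_mult_sqrt_sqrt:
  "real n powr (3 / 4) * sqrt (sqrt (real n)) = real n"
proof -
  have "sqrt (sqrt (real n)) = real n powr (1 / 4)"
    by (simp add: powr_half_sqrt[symmetric] powr_powr)
  then show ?thesis
    by (simp add: powr_add[symmetric])
qed
lemma lower_bound_primal_ill_conditioned:
  assumes "0 < c0" "4 \<le> n" and \<mu>: "0 < \<mu>x" "0 < \<mu>y" "2 * \<mu>x \<le> L" and R: "0 < Rx" "0 < Ry"
  shows "\<exists>s>0. \<forall>\<epsilon>>0. ereal (1 / (40 * (3 + c0)) * (real n powr (3 / 4) * sqrt (L / \<mu>x) * ln (s / \<epsilon>)))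
    \<le> ereal_of_enat (m_CC c0 n \<epsilon> Rx Ry L \<mu>x \<mu>y)"
proof -
  define w where "w = L / (10 * sqrt (real n))"
  have w: "0 < w"
    using assms by (simp add: w_def)
  define r where "r = sqrt (\<mu>x / w)"
  obtain \<theta> where \<theta>: "0 < \<theta>" "\<theta> < 1" and \<mu>_eq: "\<mu>x = w * (\<theta> + 1 / \<theta> - 2)"
    and ln\<theta>: "ln (1 / \<theta>) \<le> 2 * r"
    unfolding r_def by (rule obtain_straight_decay_rate[OF \<mu>(1) w])
  define a where "a = Rx * sqrt (1 - \<theta>\<^sup>2)"
  have \<theta>2: "0 < 1 - \<theta>\<^sup>2"
    using \<theta> by (simp add: power_less_one_iff)
  have a: "0 < a"
    using R \<theta>2 by (simp add: a_def)
  have sums: "(\<Sum>i<k. (a * \<theta> ^ i)\<^sup>2) \<le> Rx\<^sup>2" for k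
  proof -
    have "(\<Sum>i<k. (a * \<theta> ^ i)\<^sup>2) = a\<^sup>2 * (\<Sum>i<k. (\<theta> ^ i)\<^sup>2)"
      by (simp add: power_mult_distrib sum_distrib_left)
    also have "\<dots> \<le> a\<^sup>2 * (1 / (1 - \<theta>\<^sup>2))"
      using sum_powers_le[OF \<theta>] by (intro mult_left_mono) auto
    also have "\<dots> = Rx\<^sup>2"
      using \<theta>2 by (simp add: a_def power_mult_distrib)
    finally show ?thesis .
  qed
  have W: "real n powr (3 / 4) * sqrt (L / \<mu>x) * (2 * ln (1 / \<theta>)) \<le> 20 * real n"
  proof -
    note n = powr_three_quarters_mult_sqrt_sqrt[of n]
    have "sqrt (L / \<mu>x) * r = sqrt (10 * sqrt (real n))"
      unfolding r_def real_sqrt_mult[symmetric] using \<mu> by (simp add: w_def)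
    also have "\<dots> \<le> 4 * sqrt (sqrt (real n))"
    proof -
      have "sqrt 10 \<le> (4::real)"
        by (intro real_le_lsqrt) auto
      then show ?thesis
        by (simp add: real_sqrt_mult mult_right_mono)
    qed
    finally have *: "sqrt (L / \<mu>x) * r \<le> 4 * sqrt (sqrt (real n))" .
    have "real n powr (3 / 4) * sqrt (L / \<mu>x) * (2 * ln (1 / \<theta>)) \<le> real n powr (3 / 4) * sqrt (L / \<mu>x) * (2 * (2 * r))"
      using ln\<theta> \<mu> by (intro mult_left_mono) auto
    also have "\<dots> = 4 * (real n powr (3 / 4) * (sqrt (L / \<mu>x) * r))"
      by simp
    also have "\<dots> \<le> 4 * (real n powr (3 / 4) * (4 * sqrt (sqrt (real n))))"
      using * by (intro mult_left_mono) auto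
    also have "\<dots> = 16 * real n"
      using n by simp
    finally show ?thesis
      by simp
  qed
  have "ereal (1 / (40 * (3 + c0)) * (20 * real n) * real (2 * m)) \<le> ereal_of_enat (m_CC c0 n \<epsilon> Rx Ry L \<mu>x \<mu>y)"
    if "0 < m" and \<epsilon>: "\<epsilon> \<le> \<mu>x / 4 * a\<^sup>2 * (\<theta> ^ (2 * m))\<^sup>2" for \<epsilon> m
  proof -
    have "ereal (real (2 * m) * real n / (2 * (3 + c0))) \<le> ereal_of_enat (m_CC c0 n \<epsilon> Rx Ry L \<mu>x \<mu>y)"
    proof (rule m_CC_ge_straight_chain[where \<xi> = 0 and rx = "\<lambda>i. a * \<theta> ^ i" and a = a and \<theta> = \<theta> and w = w])
      show "\<epsilon> \<le> \<mu>x / 4 * (a * \<theta> ^ (2 * m))\<^sup>2"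
        using \<epsilon> by (simp add: power_mult_distrib mult.assoc)
      show "\<mu>x = w * (\<theta> + 1 / \<theta> - 2)"
        by (rule \<mu>_eq)
      show "(\<Sum>i<Suc (2 * m). (a * \<theta> ^ i)\<^sup>2) \<le> Rx\<^sup>2"
        by (rule sums)
    qed (use assms that a w \<theta> in \<open>auto simp: w_def\<close>)
    moreover have "real (2 * m) * real n / (2 * (3 + c0)) = 1 / (40 * (3 + c0)) * (20 * real n) * real (2 * m)"
      using assms(1) by (simp add: divide_simps)
    ultimately show ?thesis
      by (simp only:)
  qed
  then show ?thesis
    using \<theta> a \<mu> assms W by (intro scale_from_chain_length[of \<theta> "\<mu>x / 4 * a\<^sup>2" _ _ "20 * real n"]) auto
qed

text \<open>
  The chain has two nodes, with saddle point \<open>(Rx / \<theta>, Rx)\<close>. The box is a segment on which node 0 is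
  constant, so its diameter does not see the size of that node.
\<close>
lemma lower_bound_linear:
  assumes "0 < c0" "4 \<le> n" and \<mu>: "0 < \<mu>x" "0 < \<mu>y" "2 * \<mu>x \<le> L" and R: "0 < Rx" "0 < Ry"
    and \<epsilon>: "\<epsilon> \<le> \<mu>x / 4 * Rx\<^sup>2"
  shows "ereal (real n / (2 * (3 + c0))) \<le> ereal_of_enat (m_CC c0 n \<epsilon> Rx Ry L \<mu>x \<mu>y)"
proof -
  define w where "w = L / (10 * sqrt (real n))"
  have w: "0 < w"
    using assms by (simp add: w_def)
  obtain \<theta> where \<theta>: "0 < \<theta>" "\<theta> < 1" and \<mu>_eq: "\<mu>x = w * (\<theta> + 1 / \<theta> - 2)"
    by (rule obtain_straight_decay_rate[OF \<mu>(1) w])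
  have "ereal (real 1 * real n / (2 * (3 + c0))) \<le> ereal_of_enat (m_CC c0 n \<epsilon> Rx Ry L \<mu>x \<mu>y)"
  proof (rule m_CC_ge_straight_chain[where p = 1 and \<xi> = "Rx / \<theta>" and rx = "\<lambda>i. if i = 0 then 0 else Rx"
        and a = "Rx / \<theta>" and \<theta> = \<theta> and w = w])
    show "\<bar>Rx / \<theta> * \<theta> ^ i - (if i = 0 then Rx / \<theta> else 0)\<bar> \<le> (if i = 0 then 0 else Rx)" if "i \<le> 1" for i
      using that \<theta> R by (cases i) auto
    show "\<mu>x = w * (\<theta> + 1 / \<theta> - 2)"
      by (rule \<mu>_eq)
  qed (use assms w \<theta> in \<open>auto simp: w_def\<close>)
  then show ?thesis
    by simp
qed

lemma ln_scale_mono: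
  fixes C W W' C' s s' \<epsilon> :: real
  assumes "ereal (C * (W * ln (s' / \<epsilon>))) \<le> M" "0 \<le> M" "0 < \<epsilon>" "0 < s" "s \<le> s'" "0 \<le> C'" "0 \<le> W'"
    "C' * W' \<le> C * W"
  shows "ereal (C' * (W' * ln (s / \<epsilon>))) \<le> M"
proof (cases "0 \<le> ln (s / \<epsilon>)")
  case True
  have "C' * (W' * ln (s / \<epsilon>)) = C' * W' * ln (s / \<epsilon>)"
    by simp
  also have "\<dots> \<le> C * W * ln (s' / \<epsilon>)"
  proof (rule mult_mono)
    show "ln (s / \<epsilon>) \<le> ln (s' / \<epsilon>)"
      using assms by (simp add: divide_right_mono)
    show "0 \<le> C * W"
      using mult_nonneg_nonneg[OF assms(6,7)] assms(8) by linarith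
  qed (use assms True in auto)
  finally have "ereal (C' * (W' * ln (s / \<epsilon>))) \<le> ereal (C * (W * ln (s' / \<epsilon>)))"
    by (simp add: mult.assoc)
  then show ?thesis
    using assms(1) by (rule order_trans)
next
  case False
  then have "ereal (C' * (W' * ln (s / \<epsilon>))) \<le> 0"
    using assms by (simp add: mult_nonneg_nonpos)
  then show ?thesis
    using assms(2) by (rule order_trans)
qed

theorem theorem5p1:
  fixes c0 c1 c2 :: real
  assumes "c0 > 0" and "c1 > 0" and "c2 > 0"
  shows "\<exists>(c::real)>0. \<forall>(n::nat) (L::real) (\<mu>x::real) (\<mu>y::real) (Rx::real) (Ry::real) (\<kappa>x::real) (\<kappa>y::real).
    n \<ge> 4 \<and> L > 0 \<and> \<mu>x > 0 \<and> \<mu>y > 0 \<and> Rx > 0 \<and> Ry > 0 \<and>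
    \<kappa>x = L / \<mu>x \<and> \<kappa>y = L / \<mu>y \<and> \<kappa>x \<ge> \<kappa>y \<and> \<kappa>y \<ge> 2 \<longrightarrow>
    (\<exists>(s::real)>0. \<forall>(\<epsilon>::real)>0.
      \<epsilon> \<le> Min {real n * \<mu>x * Rx\<^sup>2 / (800 * \<kappa>x * \<kappa>y), \<mu>x * Rx\<^sup>2 / 720, \<mu>y * Ry\<^sup>2 / 800} \<longrightarrow>
      (\<kappa>x \<ge> c1 * sqrt (real n) \<and> \<kappa>y \<ge> c1 * sqrt (real n) \<longrightarrow>
         ereal_of_enat (m_CC c0 n \<epsilon> Rx Ry L \<mu>x \<mu>y)
           \<ge> ereal (c * ((real n + sqrt (\<kappa>x * \<kappa>y * real n)) * ln (s / \<epsilon>)))) \<and>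
      (\<kappa>x \<ge> c1 * sqrt (real n) \<and> \<kappa>y \<le> c2 * sqrt (real n) \<longrightarrow>
         ereal_of_enat (m_CC c0 n \<epsilon> Rx Ry L \<mu>x \<mu>y)
           \<ge> ereal (c * ((real n + real n powr (3 / 4) * sqrt \<kappa>x) * ln (s / \<epsilon>)))) \<and>
      (\<kappa>x \<le> c2 * sqrt (real n) \<and> \<kappa>y \<le> c2 * sqrt (real n) \<longrightarrow>
         ereal_of_enat (m_CC c0 n \<epsilon> Rx Ry L \<mu>x \<mu>y) \<ge> ereal (c * real n)))"
proof -
  \<comment> \<open>The factor b is chosen for absorbing the summand n: if \<open>2 * b * n \<le> W\<close>, then \<open>b * (n + W) \<le> W\<close>.\<close>
  define b where "b = min 1 (min c1 (sqrt c1)) / 2"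
  define C where "C = 1 / (40 * (3 + c0))"
  define c where "c = C * b"
  have b: "0 < b" "b \<le> 1 / 2" "2 * b \<le> c1" "2 * b \<le> sqrt c1"
    using assms by (auto simp: b_def)
  have C: "0 < C"
    using assms by (simp add: C_def)
  have c: "0 < c"
    using b C by (simp add: c_def)
  have absorb: "c * (x + y) \<le> C * y" if "2 * b * x \<le> y" "0 \<le> x" "0 \<le> y" for x y
  proof -
    have "b * (x + y) \<le> y"
      using that b mult_right_mono[OF b(2) that(3)] by (simp add: algebra_simps)
    then show ?thesis
      using C by (simp add: c_def mult.assoc)
  qed
  show ?thesis
  proof (rule exI[of _ c], intro conjI allI impI)
    show "0 < c"
      by (rule c)
  next
    fix n :: nat and L \<mu>x \<mu>y Rx Ry \<kappa>x \<kappa>y :: real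
    assume H: "n \<ge> 4 \<and> L > 0 \<and> \<mu>x > 0 \<and> \<mu>y > 0 \<and> Rx > 0 \<and> Ry > 0 \<and>
      \<kappa>x = L / \<mu>x \<and> \<kappa>y = L / \<mu>y \<and> \<kappa>x \<ge> \<kappa>y \<and> \<kappa>y \<ge> 2"
    let ?M = "\<lambda>\<epsilon>. ereal_of_enat (m_CC c0 n \<epsilon> Rx Ry L \<mu>x \<mu>y)"
    let ?W1 = "sqrt (\<kappa>x * \<kappa>y * real n)"
    let ?W2 = "real n powr (3 / 4) * sqrt \<kappa>x"
    have \<mu>: "\<mu>x \<le> \<mu>y" "2 * \<mu>y \<le> L" "2 * \<mu>x \<le> L"
      using H by (auto simp: field_simps)
    obtain s1 where s1: "0 < s1" "\<And>\<epsilon>. 0 < \<epsilon> \<Longrightarrow> ereal (C * (?W1 * ln (s1 / \<epsilon>))) \<le> ?M \<epsilon>"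
      using lower_bound_both_ill_conditioned[of c0 n \<mu>x \<mu>y L Rx Ry] assms H \<mu> unfolding C_def by auto
    obtain s2 where s2: "0 < s2" "\<And>\<epsilon>. 0 < \<epsilon> \<Longrightarrow> ereal (C * (?W2 * ln (s2 / \<epsilon>))) \<le> ?M \<epsilon>"
      using lower_bound_primal_ill_conditioned[of c0 n \<mu>x \<mu>y L Rx Ry] assms H \<mu> unfolding C_def by auto
    show "\<exists>s>0. \<forall>\<epsilon>>0. \<epsilon> \<le> Min {real n * \<mu>x * Rx\<^sup>2 / (800 * \<kappa>x * \<kappa>y), \<mu>x * Rx\<^sup>2 / 720, \<mu>y * Ry\<^sup>2 / 800} \<longrightarrow>
      (\<kappa>x \<ge> c1 * sqrt (real n) \<and> \<kappa>y \<ge> c1 * sqrt (real n) \<longrightarrow>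
         ?M \<epsilon> \<ge> ereal (c * ((real n + ?W1) * ln (s / \<epsilon>)))) \<and>
      (\<kappa>x \<ge> c1 * sqrt (real n) \<and> \<kappa>y \<le> c2 * sqrt (real n) \<longrightarrow>
         ?M \<epsilon> \<ge> ereal (c * ((real n + ?W2) * ln (s / \<epsilon>)))) \<and>
      (\<kappa>x \<le> c2 * sqrt (real n) \<and> \<kappa>y \<le> c2 * sqrt (real n) \<longrightarrow> ?M \<epsilon> \<ge> ereal (c * real n))"
    proof (intro exI[of _ "min s1 s2"] conjI allI impI)
      show "0 < min s1 s2"
        using s1 s2 by simp
    next
      fix \<epsilon> :: real
      assume \<epsilon>: "0 < \<epsilon>" and "\<kappa>x \<ge> c1 * sqrt (real n) \<and> \<kappa>y \<ge> c1 * sqrt (real n)"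
      then have "c1 * sqrt (real n) * (c1 * sqrt (real n)) \<le> \<kappa>x * \<kappa>y"
        using assms H by (intro mult_mono) auto
      then have "(c1 * real n)\<^sup>2 \<le> \<kappa>x * \<kappa>y * real n"
        using mult_right_mono[of "c1 * sqrt (real n) * (c1 * sqrt (real n))" "\<kappa>x * \<kappa>y" "real n"]
        by (simp add: power2_eq_square algebra_simps)
      then have "c1 * real n \<le> ?W1"
        by (rule real_le_rsqrt)
      moreover have "2 * b * real n \<le> c1 * real n"
        using b(3) by (rule mult_right_mono) simp
      ultimately have "2 * b * real n \<le> ?W1"
        by linarith
      then have "c * (real n + ?W1) \<le> C * ?W1"
        by (rule absorb) (use H in auto)
      then show "?M \<epsilon> \<ge> ereal (c * ((real n + ?W1) * ln (min s1 s2 / \<epsilon>)))"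
        using \<epsilon> s1 s2 c H by (intro ln_scale_mono[OF s1(2)[OF \<epsilon>]]) auto
    next
      fix \<epsilon> :: real
      assume \<epsilon>: "0 < \<epsilon>" and "\<kappa>x \<ge> c1 * sqrt (real n) \<and> \<kappa>y \<le> c2 * sqrt (real n)"
      then have "sqrt (c1 * sqrt (real n)) \<le> sqrt \<kappa>x"
        by simp
      moreover note powr_three_quarters_mult_sqrt_sqrt[of n]
      ultimately have "sqrt c1 * real n \<le> ?W2"
        using mult_left_mono[of "sqrt (c1 * sqrt (real n))" "sqrt \<kappa>x" "real n powr (3 / 4)"]
        by (simp add: real_sqrt_mult mult.left_commute)
      moreover have "2 * b * real n \<le> sqrt c1 * real n"
        using b(4) by (rule mult_right_mono) simp
      ultimately have "2 * b * real n \<le> ?W2"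
        by linarith
      then have "c * (real n + ?W2) \<le> C * ?W2"
        by (rule absorb) (use H in auto)
      then show "?M \<epsilon> \<ge> ereal (c * ((real n + ?W2) * ln (min s1 s2 / \<epsilon>)))"
        using \<epsilon> s1 s2 c H by (intro ln_scale_mono[OF s2(2)[OF \<epsilon>]]) auto
    next
      fix \<epsilon> :: real
      assume \<epsilon>: "0 < \<epsilon>" "\<epsilon> \<le> Min {real n * \<mu>x * Rx\<^sup>2 / (800 * \<kappa>x * \<kappa>y), \<mu>x * Rx\<^sup>2 / 720, \<mu>y * Ry\<^sup>2 / 800}"
      then have "\<epsilon> \<le> \<mu>x * Rx\<^sup>2 / 720"
        by simp
      moreover have "0 \<le> \<mu>x * Rx\<^sup>2"
        using H by simp
      ultimately have "\<epsilon> \<le> \<mu>x / 4 * Rx\<^sup>2"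
        by simp
      then have "ereal (real n / (2 * (3 + c0))) \<le> ?M \<epsilon>"
        using assms H \<mu> by (intro lower_bound_linear) auto
      moreover have "c * real n \<le> real n / (2 * (3 + c0))"
      proof -
        have "c \<le> C * 1"
          unfolding c_def using b C by (intro mult_left_mono) auto
        also have "\<dots> \<le> 1 / (2 * (3 + c0))"
          using assms by (simp add: C_def field_simps)
        finally show ?thesis
          using mult_right_mono[of c "1 / (2 * (3 + c0))" "real n"] by simp
      qed
      ultimately show "?M \<epsilon> \<ge> ereal (c * real n)"
        using order_trans[of "ereal (c * real n)" "ereal (real n / (2 * (3 + c0)))"] by simp
    qed
  qed
qed

end
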